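(* Let $M=M(V)\in\mathbb{N}^*$ be such that $\frac{M}{V}\to\rho\in(0,\infty)$ as $V\to\infty$. Then the scaled random variables $$\bar\eta:=\frac1V(\eta_1,\dots,\eta_M)$$ (viewed as elements of $\mathbb{R}_+^\infty$ by setting $\eta_r=0$ for $r>M$), where $\eta=(\eta_1,\dots,\eta_M)$ has law $\pi^{V,M}$, satisfy, as $V\to\infty$, a large deviation principle on $\mathbb{R}_+^\infty$ equipped with the pointwise (product) topology, with speed $V$ and good rate function $$J_\rho(\ell)=\begin{cases} H(\ell|c^\rho)-\left(\rho-\sum_{r=1}^\infty r\ell_r\right)\log\frac{\varphi(\rho)}{\phi_c} & \text{if }\sum_{r=1}^\infty r\ell_r\le\rho,\\ \infty & \text{otherwise,}\end{cases}$$ where $c^\rho\in\mathbb{R}_+^\infty$ is given by $c^\rho_r=Q_r\varphi(\rho)^r$ for all $r\ge1$, and $$H(\ell|c^\rho)=\sum_{r=1}^\infty\left(\ell_r\log\left(\frac{\ell_r}{Q_r\varphi(\rho)^r}\right)-\ell_r+Q_r\varphi(\rho)^r\right).$$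
   Context: Notation: $\mathbb{N}=\{0,1,2,\dots\}$, $\mathbb{N}^*=\{1,2,\dots\}$, $\mathbb{R}_+=[0,\infty)$, $\mathbb{R}_+^\infty=\mathbb{R}_+^{\mathbb{N}^*}$; $0\log 0=0$. $(Q_r)_{r\ge1}$ is a sequence of positive real numbers such that $\lim_{r\to\infty}Q_r^{1/r}$ exists in $(0,\infty)$; $\phi_c\in(0,\infty)$ is the reciprocal of this limit, i.e. the radius of convergence of $F(\phi):=\sum_{r\ge1}rQ_r\phi^r$. Set $\rho_c:=\sup_{0\le\phi<\phi_c}F(\phi)\in[0,\infty]$. For finite $\rho$ with $0\le\rho\le\rho_c$, $\varphi(\rho)$ denotes the unique root $\phi$ of $F(\phi)=\rho$; if $\rho_c<\infty$, for $\rho_c\le\rho<\infty$ set $\varphi(\rho):=\phi_c$. For real $V>0$ and $M\in\mathbb{N}^*$, $\pi^{V,M}$ is the probability measure on $\{\eta\in\mathbb{N}^M:\sum_{i=1}^M i\eta_i=M\}$ given by $$\pi^{V,M}(\eta)=\frac1{Z^{V,M}}\prod_{i=1}^M\frac{(VQ_i)^{\eta_i}}{\eta_i!},$$ with $Z^{V,M}$ the normalisation constant. (It is the invariant measure of the mean-field reversible coagulation-fragmentation process with volume $V$ and total mass $M$.) *)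

theory Defs
  imports "HOL-Probability.Probability"
begin

section \<open>Large deviation principles\<close>

text \<open>Logarithm of a probability, with the convention that the logarithm of 0 is minus infinity
  (the library's real logarithm has \<^term>\<open>ln (0::real) = 0\<close>).\<close>

definition ereal_log :: "real \<Rightarrow> ereal" where
  "ereal_log x = (if x = 0 then -\<infinity> else ereal (ln x))"

definition borel_measure_of :: "'a topology \<Rightarrow> 'a measure" where
  "borel_measure_of X = sigma (topspace X) {U. openin X U}"

text \<open>Closedness of the sublevel sets is lower semicontinuity, compactness is goodness.\<close>

definition good_rate_function :: "'a topology \<Rightarrow> ('a \<Rightarrow> ereal) \<Rightarrow> bool" where
  "good_rate_function X I \<longleftrightarrow>
     (\<forall>x\<in>topspace X. 0 \<le> I x) \<and>
     (\<forall>a::real. closedin X {x \<in> topspace X. I x \<le> ereal a}) \<and>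
     (\<forall>a::real. compactin X {x \<in> topspace X. I x \<le> ereal a})"

text \<open>The infimum of the rate function over the empty set is \<^term>\<open>\<infinity> :: ereal\<close>.\<close>

definition large_deviation_principle ::
  "'a topology \<Rightarrow> ('i \<Rightarrow> 'a measure) \<Rightarrow> ('i \<Rightarrow> real) \<Rightarrow> 'i filter \<Rightarrow> ('a \<Rightarrow> ereal) \<Rightarrow> bool" where
  "large_deviation_principle X \<mu> speed Fl I \<longleftrightarrow>
     filterlim speed at_top Fl \<and>
     (\<forall>\<^sub>F v in Fl. prob_space (\<mu> v) \<and> space (\<mu> v) = topspace X \<and>
                   sets (\<mu> v) = sets (borel_measure_of X)) \<and>
     (\<forall>C. closedin X C \<longrightarrow>
        Limsup Fl (\<lambda>v. ereal_log (measure (\<mu> v) C) / ereal (speed v)) \<le> - (INF x\<in>C. I x)) \<and>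
     (\<forall>U. openin X U \<longrightarrow>
        - (INF x\<in>U. I x) \<le> Liminf Fl (\<lambda>v. ereal_log (measure (\<mu> v) U) / ereal (speed v)))"

section \<open>The generating function and the fugacity\<close>

text \<open>Sequences indexed by the positive integers are functions on \<^typ>\<open>nat\<close> whose value at 0 is
  never used; series over positive \<open>r\<close> are therefore written with index \<^term>\<open>Suc r\<close>.\<close>

definition \<phi>_crit :: "(nat \<Rightarrow> real) \<Rightarrow> real" where
  "\<phi>_crit Q = inverse (lim (\<lambda>r. root r (Q r)))"

text \<open>For nonnegative \<open>\<phi>\<close> the value is \<^term>\<open>\<infinity> :: ereal\<close> exactly if the series diverges.\<close>

definition F_gen :: "(nat \<Rightarrow> real) \<Rightarrow> real \<Rightarrow> ereal" where
  "F_gen Q \<phi> = (\<Sum>r. ereal (real (Suc r) * Q (Suc r) * \<phi> ^ Suc r))"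

definition \<rho>_crit :: "(nat \<Rightarrow> real) \<Rightarrow> ereal" where
  "\<rho>_crit Q = (SUP \<phi>\<in>{0..<\<phi>_crit Q}. F_gen Q \<phi>)"

definition fugacity :: "(nat \<Rightarrow> real) \<Rightarrow> real \<Rightarrow> real" where
  "fugacity Q \<rho> =
     (if ereal \<rho> \<le> \<rho>_crit Q then (THE \<phi>. \<phi> \<in> {0..\<phi>_crit Q} \<and> F_gen Q \<phi> = ereal \<rho>)
      else \<phi>_crit Q)"

section \<open>The invariant measures of the coagulation-fragmentation process\<close>

definition partition_states :: "nat \<Rightarrow> (nat \<Rightarrow> nat) set" where
  "partition_states M = {\<eta> \<in> {1..M} \<rightarrow>\<^sub>E UNIV. (\<Sum>i=1..M. i * \<eta> i) = M}"

definition cf_weight :: "(nat \<Rightarrow> real) \<Rightarrow> real \<Rightarrow> nat \<Rightarrow> (nat \<Rightarrow> nat) \<Rightarrow> real" where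
  "cf_weight Q V M \<eta> = (\<Prod>i=1..M. (V * Q i) ^ \<eta> i / fact (\<eta> i))"

definition cf_normalisation :: "(nat \<Rightarrow> real) \<Rightarrow> real \<Rightarrow> nat \<Rightarrow> real" where
  "cf_normalisation Q V M = (\<Sum>\<eta>\<in>partition_states M. cf_weight Q V M \<eta>)"

definition cf_measure :: "(nat \<Rightarrow> real) \<Rightarrow> real \<Rightarrow> nat \<Rightarrow> (nat \<Rightarrow> nat) measure" where
  "cf_measure Q V M =
     point_measure (partition_states M)
       (\<lambda>\<eta>. ennreal (cf_weight Q V M \<eta> / cf_normalisation Q V M))"

section \<open>The space of nonnegative sequences and the scaled variables\<close>

definition nonneg_seq_topology :: "(nat \<Rightarrow> real) topology" where
  "nonneg_seq_topology = product_topology (\<lambda>_. top_of_set {0..}) {1..}"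

definition scaled_sizes :: "real \<Rightarrow> nat \<Rightarrow> (nat \<Rightarrow> nat) \<Rightarrow> nat \<Rightarrow> real" where
  "scaled_sizes V M \<eta> = (\<lambda>r\<in>{1..}. if r \<le> M then real (\<eta> r) / V else 0)"

definition scaled_law :: "(nat \<Rightarrow> real) \<Rightarrow> real \<Rightarrow> nat \<Rightarrow> (nat \<Rightarrow> real) measure" where
  "scaled_law Q V M =
     distr (cf_measure Q V M) (borel_measure_of nonneg_seq_topology) (scaled_sizes V M)"

section \<open>The rate function\<close>

definition c_seq :: "(nat \<Rightarrow> real) \<Rightarrow> real \<Rightarrow> nat \<Rightarrow> real" where
  "c_seq Q \<rho> = (\<lambda>r\<in>{1..}. Q r * fugacity Q \<rho> ^ r)"

text \<open>For nonnegative \<open>l\<close> and positive \<open>c\<close> all terms are nonnegative, so that the series has a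
  value in the extended reals.\<close>

definition relative_entropy_seq :: "(nat \<Rightarrow> real) \<Rightarrow> (nat \<Rightarrow> real) \<Rightarrow> ereal" where
  "relative_entropy_seq l c =
     (\<Sum>r. ereal (l (Suc r) * ln (l (Suc r) / c (Suc r)) - l (Suc r) + c (Suc r)))"

definition total_mass :: "(nat \<Rightarrow> real) \<Rightarrow> ereal" where
  "total_mass l = (\<Sum>r. ereal (real (Suc r) * l (Suc r)))"

definition J_rate :: "(nat \<Rightarrow> real) \<Rightarrow> real \<Rightarrow> (nat \<Rightarrow> real) \<Rightarrow> ereal" where
  "J_rate Q \<rho> l =
     (if total_mass l \<le> ereal \<rho>
      then relative_entropy_seq l (c_seq Q \<rho>)
             - (ereal \<rho> - total_mass l) * ereal (ln (fugacity Q \<rho> / \<phi>_crit Q))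
      else \<infinity>)"

end

theory Submission
  imports Defs "HOL-Real_Asymp.Real_Asymp"
begin

text \<open>Put \<open>q r = Q r * \<phi>c ^ r\<close>. Since \<open>\<phi>c ^ (\<Sum>i. i * \<eta> i)\<close> is constant on the states of mass \<open>M\<close>, \<open>Q\<close>
  and \<open>q\<close> define the same measure, and \<open>ln (q r) / r\<close> tends to 0. By Stirling's bounds the weight of a state
  is \<open>exp (- V * G l)\<close>, where \<open>l\<close> is the scaled state and \<open>G l = (\<Sum>r. l r * ln (l r / q r) - l r)\<close>, up
  to factors that are subexponential if only boundedly many sizes occur. The decisive point is that \<open>G\<close> is
  continuous, not just lower semicontinuous, on the compact sets \<open>{l. (\<Sum>r. r * l r) \<le> m}\<close>: the tails of
  the series are uniformly small because \<open>ln (q r)\<close> and \<open>ln r\<close> are \<open>o(r)\<close>. The upper bound follows as the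
  number of partitions of \<open>M\<close> is subexponential; for the lower bound, missing mass is moved to a far-away
  size at vanishing cost. The rate function is thus \<open>G\<close> minus its minimum on \<open>{l. (\<Sum>r. r * l r) \<le> \<rho>}\<close>.
  Expanding \<open>H(l|c)\<close> shows that \<open>J\<close> differs from \<open>G\<close> by a constant there, and \<open>J \<ge> 0\<close> with \<open>J c = 0\<close>
  identifies the constant.\<close>

section \<open>Sequences of bounded mass\<close>

text \<open>\<open>PiE\<close> fixes the value at index 0 to be \<open>undefined\<close>, so these
  functions on all of \<open>nat\<close> are exactly the points of the product over the positive
  indices.\<close>

definition nonneg_seqs :: "(nat \<Rightarrow> real) set" where
  "nonneg_seqs = PiE {1..} (\<lambda>_. {0..})"

lemma nonneg_seqsD: "l \<in> nonneg_seqs \<Longrightarrow> 0 \<le> l (Suc r)"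
  by (auto simp: nonneg_seqs_def PiE_iff)

lemma nonneg_seqs_at_0: "l \<in> nonneg_seqs \<Longrightarrow> l 0 = undefined"
  by (auto simp: nonneg_seqs_def PiE_iff extensional_def)

lemma topspace_nonneg_seq_topology [simp]: "topspace nonneg_seq_topology = nonneg_seqs"
  by (simp add: nonneg_seq_topology_def nonneg_seqs_def)

lemma continuous_on_coordinate: "continuous_on A (\<lambda>l::nat \<Rightarrow> real. l i)"
  by (rule continuous_on_subset[OF continuous_on_product_coordinates]) simp

text \<open>Realises the product as a subspace of the function space, where the type-class notions
  \<open>closed\<close> and \<open>compact\<close> are available. The identity is continuous in both
  directions, coordinate by coordinate.\<close>

lemma nonneg_seq_topology_eq: "nonneg_seq_topology = top_of_set nonneg_seqs"
proof -
  let ?T = "top_of_set nonneg_seqs"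
  have 1: "continuous_map ?T nonneg_seq_topology (\<lambda>l. l)"
    unfolding nonneg_seq_topology_def
    unfolding continuous_map_componentwise
  proof (intro conjI ballI)
    show "(\<lambda>l. l) ` topspace ?T \<subseteq> extensional {1..}"
      by (auto simp: nonneg_seqs_def PiE_iff)
  next
    fix k :: nat assume k: "k \<in> {1..}"
    show "continuous_map ?T (top_of_set {0..}) (\<lambda>l. l k)"
      using k by (auto simp: continuous_on_coordinate nonneg_seqs_def PiE_iff)
  qed
  have 2: "continuous_map nonneg_seq_topology euclidean (\<lambda>l. l)"
  proof -
    have "continuous_map nonneg_seq_topology euclidean (\<lambda>l. l k)" for k
    proof (cases "k \<in> {1..}")
      case True
      have "continuous_map nonneg_seq_topology (top_of_set {0..}) (\<lambda>l. l k)"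
        unfolding nonneg_seq_topology_def by (rule continuous_map_product_coordinates[OF True])
      then show ?thesis by (simp add: continuous_map_in_subtopology)
    next
      \<comment> \<open>Only index 0 remains, where all points take the same value.\<close>
      case False
      have "continuous_map nonneg_seq_topology euclidean (\<lambda>l. undefined::real)" by simp
      then show ?thesis
        by (rule continuous_map_eq) (use False in \<open>auto simp: nonneg_seqs_def PiE_iff extensional_def\<close>)
    qed
    then show ?thesis
      by (simp flip: euclidean_product_topology add: continuous_map_componentwise_UNIV)
  qed
  have 2: "continuous_map nonneg_seq_topology ?T (\<lambda>l. l)"
    using 2 by (auto simp: continuous_map_in_subtopology)
  show ?thesis
    unfolding topology_eq
  proof (intro allI iffI)
    fix U assume U: "openin nonneg_seq_topology U"
    then have "{x \<in> topspace ?T. x \<in> U} = U" using openin_subset by fastforce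
    with openin_continuous_map_preimage[OF 1 U] show "openin ?T U" by simp
  next
    fix U assume U: "openin ?T U"
    then have "{x \<in> topspace nonneg_seq_topology. x \<in> U} = U" using openin_subset by fastforce
    with openin_continuous_map_preimage[OF 2 U] show "openin nonneg_seq_topology U" by simp
  qed
qed

lemma closed_nonneg_seqs: "closed nonneg_seqs"
proof -
  have "nonneg_seqs = {l::nat \<Rightarrow> real. l 0 = undefined} \<inter> (\<Inter>r. {l. 0 \<le> l (Suc r)})"
  proof (intro equalityI subsetI)
    fix l assume l: "l \<in> {l::nat \<Rightarrow> real. l 0 = undefined} \<inter> (\<Inter>r. {l. 0 \<le> l (Suc r)})"
    have "0 \<le> l i" if "i \<ge> 1" for i using that l by (cases i) auto
    with l show "l \<in> nonneg_seqs" by (auto simp: nonneg_seqs_def PiE_iff extensional_def Suc_le_eq)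
  qed (auto simp: nonneg_seqs_at_0 nonneg_seqsD)
  moreover have "closed {l::nat \<Rightarrow> real. l 0 = undefined}"
    by (intro closed_Collect_eq continuous_on_coordinate continuous_on_const)
  moreover have "closed {l::nat \<Rightarrow> real. 0 \<le> l (Suc r)}" for r
    by (intro closed_Collect_le continuous_on_coordinate continuous_on_const)
  ultimately show ?thesis by (metis closed_INT closed_Int)
qed

definition partial_mass :: "nat \<Rightarrow> (nat \<Rightarrow> real) \<Rightarrow> real" where
  "partial_mass n l = (\<Sum>r<n. real (Suc r) * l (Suc r))"

text \<open>Bounding every partial sum expresses \<open>total_mass l \<le> m\<close> by closed
  conditions on finitely many coordinates each, without mentioning convergence.\<close>

definition mass_ball :: "real \<Rightarrow> (nat \<Rightarrow> real) set" where
  "mass_ball m = {l \<in> nonneg_seqs. \<forall>n. partial_mass n l \<le> m}"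

lemma mass_ball_subset: "mass_ball m \<subseteq> nonneg_seqs"
  by (auto simp: mass_ball_def)

lemma mass_ball_mono: "m \<le> m' \<Longrightarrow> mass_ball m \<subseteq> mass_ball m'"
  by (auto simp: mass_ball_def intro: order_trans)

lemma continuous_on_partial_mass: "continuous_on A (partial_mass n)"
  unfolding partial_mass_def [abs_def] by (intro continuous_intros continuous_on_coordinate)

lemma closed_mass_ball: "closed (mass_ball m)"
proof -
  have "mass_ball m = nonneg_seqs \<inter> (\<Inter>n. {l. partial_mass n l \<le> m})"
    by (auto simp: mass_ball_def)
  moreover have "closed {l. partial_mass n l \<le> m}" for n
    by (intro closed_Collect_le continuous_on_partial_mass continuous_on_const)
  ultimately show ?thesis by (simp add: closed_nonneg_seqs closed_Int closed_INT)
qed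

lemma mass_ball_coordinate_le:
  assumes "l \<in> mass_ball m"
  shows "real (Suc r) * l (Suc r) \<le> m"
proof -
  have "real (Suc r) * l (Suc r) \<le> partial_mass (Suc r) l"
    unfolding partial_mass_def
    by (rule member_le_sum) (use assms in \<open>auto simp: mass_ball_def nonneg_seqsD\<close>)
  also have "\<dots> \<le> m" using assms by (simp add: mass_ball_def)
  finally show ?thesis .
qed

text \<open>Tychonoff: the ball is a closed subset of a product of compact intervals, since a
  coordinate is at most its contribution to the mass.\<close>

lemma compact_mass_ball: "compact (mass_ball m)"
proof (cases "0 \<le> m")
  case False
  \<comment> \<open>For negative \<open>m\<close> the empty partial sum, which is 0, already
    violates the bound.\<close>
  then have "mass_ball m = {}"
    using mass_ball_def partial_mass_def by (auto intro!: exI[of _ 0])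
  then show ?thesis by simp
next
  case True
  let ?B = "PiE UNIV (\<lambda>i::nat. if i = 0 then {undefined} else {0..m})"
  have "compactin (product_topology (\<lambda>_. euclidean) UNIV) ?B"
    by (auto simp: compactin_PiE)
  then have "compact ?B" by (simp add: euclidean_product_topology)
  moreover have "mass_ball m \<subseteq> ?B"
  proof
    fix l assume l: "l \<in> mass_ball m"
    have "l (Suc r) \<le> real (Suc r) * l (Suc r)" for r
      using l nonneg_seqsD[of l r] mult_right_mono[of 1 "real (Suc r)" "l (Suc r)"]
      by (simp add: mass_ball_def)
    then have "l (Suc r) \<le> m" for r using mass_ball_coordinate_le[OF l, of r] order_trans by blast
    then have "l i \<in> (if i = 0 then {undefined} else {0..m})" for i
      using l nonneg_seqsD nonneg_seqs_at_0 by (cases i) (auto simp: mass_ball_def)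
    then show "l \<in> ?B" by (simp add: PiE_iff)
  qed
  ultimately show ?thesis
    by (metis closed_mass_ball compact_Int_closed inf.absorb_iff2)
qed

lemma total_mass_le_iff:
  assumes "l \<in> nonneg_seqs"
  shows "total_mass l \<le> ereal m \<longleftrightarrow> l \<in> mass_ball m"
proof -
  have "total_mass l = (SUP n. ereal (partial_mass n l))"
    unfolding total_mass_def partial_mass_def
    by (subst suminf_ereal_eq_SUP) (auto simp: nonneg_seqsD[OF assms])
  then show ?thesis using assms by (simp add: SUP_le_iff mass_ball_def)
qed

lemma mass_ball_sums:
  assumes "l \<in> mass_ball m"
  shows "summable (\<lambda>r. real (Suc r) * l (Suc r))" "(\<Sum>r. real (Suc r) * l (Suc r)) \<le> m"
    and "total_mass l = ereal (\<Sum>r. real (Suc r) * l (Suc r))"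
proof -
  show s: "summable (\<lambda>r. real (Suc r) * l (Suc r))"
    by (rule bounded_imp_summable[where B = m])
      (use assms in \<open>auto simp: mass_ball_def nonneg_seqsD partial_mass_def simp flip: lessThan_Suc_atMost simp del: sum.lessThan_Suc\<close>)
  show "(\<Sum>r. real (Suc r) * l (Suc r)) \<le> m"
    by (rule suminf_le_const[OF s]) (use assms in \<open>auto simp: mass_ball_def partial_mass_def\<close>)
  show "total_mass l = ereal (\<Sum>r. real (Suc r) * l (Suc r))"
    unfolding total_mass_def by (rule suminf_ereal'[OF s])
qed

section \<open>Continuity of the entropy\<close>

definition cell_entropy :: "real \<Rightarrow> real \<Rightarrow> real" where
  "cell_entropy c x = x * ln (x / c) - x"

lemma cell_entropy_0 [simp]: "cell_entropy c 0 = 0"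
  by (simp add: cell_entropy_def)

lemma cell_entropy_eq:
  "0 \<le> x \<Longrightarrow> 0 < c \<Longrightarrow> cell_entropy c x = x * ln x - x * (ln c + 1)"
  by (cases "x = 0") (auto simp: cell_entropy_def ln_div algebra_simps)

text \<open>Apply \<open>ln y \<le> y - 1\<close> to \<open>y = 1 / sqrt x\<close>.\<close>

lemma abs_x_ln_x_le_sqrt:
  fixes x :: real
  assumes "0 \<le> x" "x \<le> 1"
  shows "\<bar>x * ln x\<bar> \<le> 2 * sqrt x"
proof (cases "x = 0")
  case False
  with assms have x: "x > 0" by simp
  have "- ln x = 2 * ln (1 / sqrt x)" using x by (simp add: ln_div ln_sqrt)
  also have "ln (1 / sqrt x) \<le> 1 / sqrt x - 1" using x by (intro ln_le_minus_one) auto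
  finally have "- ln x \<le> 2 / sqrt x" by simp
  then have "x * (- ln x) \<le> x * (2 / sqrt x)" using x by (intro mult_left_mono) auto
  also have "\<dots> = 2 * sqrt x" using x by (simp add: field_simps)
  finally show ?thesis using assms x by (simp add: abs_mult)
qed simp

lemma continuous_on_x_ln_x: "continuous_on {0..} (\<lambda>x::real. x * ln x)"
  unfolding continuous_on_def
proof
  fix x :: real assume "x \<in> {0..}"
  show "((\<lambda>x. x * ln x) \<longlongrightarrow> x * ln x) (at x within {0..})"
  proof (cases "x = 0")
    case True
    have "((\<lambda>x::real. x * ln x) \<longlongrightarrow> 0) (at_right 0)" by real_asymp
    then show ?thesis by (simp add: True at_within_Ici_at_right)
  next
    case False
    then show ?thesis by (intro tendsto_intros) auto
  qed
qed

lemma continuous_on_cell_entropy: "0 < c \<Longrightarrow> continuous_on {0..} (cell_entropy c)"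
  by (rule continuous_on_eq[where f = "\<lambda>x. x * ln x - x * (ln c + 1)"])
    (auto intro!: continuous_intros continuous_on_x_ln_x simp: cell_entropy_eq)

text \<open>Split at \<open>x = 1 / r ^ 4\<close>. Below it, the square root bound gives an error
  that is summable over the sizes \<open>r\<close>; above it, \<open>- ln x\<close> is at most
  \<open>4 * ln r\<close>, which leaves a term linear in \<open>x\<close>.\<close>

lemma abs_cell_entropy_le:
  assumes "0 \<le> x" "x \<le> 1" "0 < c" "1 \<le> r"
  shows "\<bar>cell_entropy c x\<bar> \<le> x * (4 * ln r + \<bar>ln c\<bar> + 1) + 2 / r\<^sup>2"
proof -
  have "\<bar>x * ln x\<bar> \<le> x * (4 * ln r) + 2 / r\<^sup>2"
  proof (cases "x \<le> 1 / r ^ 4")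
    case True
    have "\<bar>x * ln x\<bar> \<le> 2 * sqrt x" by (rule abs_x_ln_x_le_sqrt) fact+
    also have "sqrt x \<le> sqrt ((1 / r\<^sup>2)\<^sup>2)"
      using True by (simp add: power_divide flip: power_mult)
    also have "\<dots> = 1 / r\<^sup>2" by simp
    finally have "\<bar>x * ln x\<bar> \<le> 2 / r\<^sup>2" by simp
    moreover have "0 \<le> x * (4 * ln r)" using assms by simp
    ultimately show ?thesis by linarith
  next
    case False
    then have "0 < 1 / r ^ 4" "1 / r ^ 4 < x" using assms by simp_all
    then have "ln (1 / r ^ 4) < ln x" by (subst ln_less_cancel_iff) linarith+
    then have "- ln x \<le> 4 * ln r" using assms by (simp add: ln_div ln_realpow)
    then have "x * (- ln x) \<le> x * (4 * ln r)" using assms by (intro mult_left_mono) auto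
    moreover have "\<bar>x * ln x\<bar> = x * (- ln x)" using assms by (cases "x = 0") (auto simp: abs_mult)
    moreover have "0 \<le> 2 / r\<^sup>2" by simp
    ultimately show ?thesis by linarith
  qed
  moreover have "\<bar>x * (ln c + 1)\<bar> \<le> x * (\<bar>ln c\<bar> + 1)"
    using assms by (simp add: abs_mult mult_left_mono)
  ultimately show ?thesis using assms by (simp add: cell_entropy_eq algebra_simps)
qed

section \<open>Uniform convergence of the entropy series on mass balls\<close>

locale subexponential_weights =
  fixes q :: "nat \<Rightarrow> real"
  assumes q_pos: "\<And>r. r \<ge> 1 \<Longrightarrow> 0 < q r"
    and q_lim: "(\<lambda>r. ln (q r) / real r) \<longlonglongrightarrow> 0"
begin

definition entropy_sum :: "nat \<Rightarrow> (nat \<Rightarrow> real) \<Rightarrow> real" where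
  "entropy_sum n l = (\<Sum>r<n. cell_entropy (q (Suc r)) (l (Suc r)))"

definition entropy :: "(nat \<Rightarrow> real) \<Rightarrow> real" where
  "entropy l = (\<Sum>r. cell_entropy (q (Suc r)) (l (Suc r)))"

text \<open>By \<open>abs_cell_entropy_le\<close> a tail term is at most \<open>d r\<close> times
  the mass carried by its size, plus a summable error. As \<open>d\<close> tends to 0 and the total
  mass is bounded, the tails are small uniformly on the ball.\<close>

lemma uniformly_Cauchy_entropy_sum: "uniformly_Cauchy_on (mass_ball m) entropy_sum"
proof (rule uniformly_Cauchy_onI')
  fix e :: real assume e: "0 < e"
  define d where "d r = (4 * ln (real (Suc r)) + \<bar>ln (q (Suc r))\<bar> + 1) / real (Suc r)" for r
  \<comment> \<open>Chosen so that \<open>e'\<close> times the mass bound is \<open>e / 2\<close>;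
    \<open>\<bar>m\<bar> + 1\<close> is positive whatever the sign of \<open>m\<close>.\<close>
  define e' where "e' = e / (2 * (\<bar>m\<bar> + 1))"
  have "e' > 0" using e by (simp add: e'_def)
  have "(\<lambda>r. (4 * ln (real (Suc r)) + 1) / real (Suc r) + \<bar>ln (q (Suc r)) / real (Suc r)\<bar>) \<longlonglongrightarrow> 0 + \<bar>0\<bar>"
  proof (intro tendsto_add tendsto_rabs)
    show "(\<lambda>r. (4 * ln (real (Suc r)) + 1) / real (Suc r)) \<longlonglongrightarrow> 0" by real_asymp
    show "(\<lambda>r. ln (q (Suc r)) / real (Suc r)) \<longlonglongrightarrow> 0" using q_lim by (rule LIMSEQ_Suc)
  qed
  also have "(\<lambda>r. (4 * ln (real (Suc r)) + 1) / real (Suc r) + \<bar>ln (q (Suc r)) / real (Suc r)\<bar>) = d"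
    by (simp add: d_def fun_eq_iff add_divide_distrib del: of_nat_Suc)
  finally have "d \<longlonglongrightarrow> 0" by simp
  then have "eventually (\<lambda>r. d r < e') sequentially"
    using \<open>e' > 0\<close> by (rule order_tendstoD)
  then obtain N1 where N1: "\<And>r. r \<ge> N1 \<Longrightarrow> d r < e'" by (auto simp: eventually_sequentially)
  have "summable (\<lambda>r. 2 * (1 / real (Suc r) ^ 2))"
    by (intro summable_mult summable_Suc_iff[THEN iffD2] inverse_power_summable[of 2, unfolded inverse_eq_divide]) auto
  then have "summable (\<lambda>r. 2 / real (Suc r) ^ 2)" by simp
  then obtain N2 where N2: "\<And>a b. a \<ge> N2 \<Longrightarrow> norm (\<Sum>r=a..<b. 2 / real (Suc r) ^ 2) < e / 2"
    using e unfolding summable_Cauchy by (metis half_gt_zero)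
  \<comment> \<open>The third bound forces tail coordinates to be at most 1, as
    \<open>abs_cell_entropy_le\<close> demands.\<close>
  define N where "N = max (max N1 N2) (nat \<lceil>m\<rceil>)"
  have "dist (entropy_sum a l) (entropy_sum b l) < e" if l: "l \<in> mass_ball m" and ab: "a \<ge> N" "b > a" for l a b
  proof -
    have l0: "0 \<le> l (Suc r)" for r using l by (simp add: mass_ball_def nonneg_seqsD)
    have tail_term: "\<bar>cell_entropy (q (Suc r)) (l (Suc r))\<bar> \<le> e' * (real (Suc r) * l (Suc r)) + 2 / real (Suc r) ^ 2"
      if r: "r \<ge> a" for r
    proof -
      have "m \<le> real (Suc r)" using ab r unfolding N_def by linarith
      with mass_ball_coordinate_le[OF l, of r] have "real (Suc r) * l (Suc r) \<le> real (Suc r) * 1"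
        by (metis mult.right_neutral order_trans)
      then have "l (Suc r) \<le> 1" by (subst (asm) mult_le_cancel_left_pos) auto
      then have "\<bar>cell_entropy (q (Suc r)) (l (Suc r))\<bar> \<le>
        l (Suc r) * (4 * ln (real (Suc r)) + \<bar>ln (q (Suc r))\<bar> + 1) + 2 / (real (Suc r))\<^sup>2"
        by (intro abs_cell_entropy_le l0 q_pos) auto
      also have "l (Suc r) * (4 * ln (real (Suc r)) + \<bar>ln (q (Suc r))\<bar> + 1) = d r * (real (Suc r) * l (Suc r))"
        by (simp add: d_def)
      also have "\<dots> \<le> e' * (real (Suc r) * l (Suc r))"
        using N1[of r] ab r l0[of r] by (intro mult_right_mono) (auto simp: N_def)
      finally show ?thesis by simp
    qed
    have "entropy_sum b l - entropy_sum a l = (\<Sum>r=a..<b. cell_entropy (q (Suc r)) (l (Suc r)))"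
      using ab by (simp add: entropy_sum_def lessThan_atLeast0 sum_diff_nat_ivl)
    also have "\<bar>\<dots>\<bar> \<le> (\<Sum>r=a..<b. \<bar>cell_entropy (q (Suc r)) (l (Suc r))\<bar>)" by (rule sum_abs)
    also have "\<dots> \<le> (\<Sum>r=a..<b. e' * (real (Suc r) * l (Suc r)) + 2 / real (Suc r) ^ 2)"
      by (intro sum_mono tail_term) auto
    also have "\<dots> = e' * (\<Sum>r=a..<b. real (Suc r) * l (Suc r)) + (\<Sum>r=a..<b. 2 / real (Suc r) ^ 2)"
      by (simp add: sum.distrib sum_distrib_left)
    also have "(\<Sum>r=a..<b. real (Suc r) * l (Suc r)) \<le> partial_mass b l"
      unfolding partial_mass_def by (rule sum_mono2) (auto simp: l0)
    also have "partial_mass b l \<le> \<bar>m\<bar> + 1" using l by (auto simp: mass_ball_def intro: order_trans[where y = m])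
    also have "e' * (\<bar>m\<bar> + 1) = e / 2" by (simp add: e'_def field_simps add_nonneg_eq_0_iff)
    also have "(\<Sum>r=a..<b. 2 / real (Suc r) ^ 2) < e / 2"
      using N2[of a b] ab by (auto simp: N_def)
    finally show ?thesis using \<open>e' > 0\<close> by (simp add: dist_real_def abs_minus_commute)
  qed
  then show "\<exists>M. \<forall>l\<in>mass_ball m. \<forall>a\<ge>M. \<forall>b>a. dist (entropy_sum a l) (entropy_sum b l) < e" by blast
qed

lemma uniform_limit_entropy: "uniform_limit (mass_ball m) entropy_sum entropy sequentially"
proof -
  have "uniformly_convergent_on (mass_ball m) entropy_sum"
    by (rule Cauchy_uniformly_convergent[OF uniformly_Cauchy_entropy_sum])
  then have "uniform_limit (mass_ball m) entropy_sum (\<lambda>l. lim (\<lambda>n. entropy_sum n l)) sequentially"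
    by (simp add: uniformly_convergent_uniform_limit_iff)
  moreover have "lim (\<lambda>n. entropy_sum n l) = entropy l" for l
    by (simp add: entropy_sum_def entropy_def suminf_eq_lim)
  ultimately show ?thesis by simp
qed

lemma entropy_sums:
  assumes "l \<in> mass_ball m"
  shows "(\<lambda>r. cell_entropy (q (Suc r)) (l (Suc r))) sums entropy l"
  using tendsto_uniform_limitI[OF uniform_limit_entropy assms]
  by (simp add: sums_def entropy_sum_def)

lemma continuous_on_entropy: "continuous_on (mass_ball m) entropy"
proof (rule uniform_limit_theorem[OF _ uniform_limit_entropy])
  have "continuous_on (mass_ball m) (entropy_sum n)" for n
    unfolding entropy_sum_def [abs_def]
    by (intro continuous_on_sum continuous_on_compose2[OF continuous_on_cell_entropy] q_pos
        continuous_on_coordinate) (auto simp: mass_ball_def nonneg_seqsD)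
  then show "\<forall>\<^sub>F n in sequentially. continuous_on (mass_ball m) (entropy_sum n)" by simp
qed simp

end

section \<open>Weights of states\<close>

lemma partition_states_le:
  assumes \<eta>: "\<eta> \<in> partition_states M" and i: "i \<in> {1..M}"
  shows "\<eta> i \<le> M"
proof -
  have "\<eta> i \<le> i * \<eta> i" using i by simp
  also have "\<dots> \<le> (\<Sum>i=1..M. i * \<eta> i)" using i by (intro member_le_sum) auto
  finally show ?thesis using \<eta> by (simp add: partition_states_def)
qed

lemma partition_states_subset: "partition_states M \<subseteq> PiE {1..M} (\<lambda>_. {..M})"
proof
  fix \<eta> assume "\<eta> \<in> partition_states M"
  then show "\<eta> \<in> PiE {1..M} (\<lambda>_. {..M})"
    using partition_states_le[of \<eta> M] unfolding partition_states_def PiE_iff by simp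
qed

lemma finite_partition_states [simp]: "finite (partition_states M)"
  by (rule finite_subset[OF partition_states_subset]) (simp add: finite_PiE)

text \<open>The product over \<open>i\<close> of \<open>1 / (1 - x ^ i)\<close> is the generating function of the number of
  partitions; it shows that this number grows subexponentially.\<close>

lemma card_partition_states_le:
  fixes x :: real
  assumes x: "0 < x" "x < 1"
  shows "real (card (partition_states M)) * x ^ M \<le> exp (1 / (1 - x)\<^sup>2)"
proof -
  have xi: "0 < x ^ i \<and> x ^ i < 1" if "i \<ge> 1" for i
    using x that by (simp add: power_less_one_iff)
  have "real (card (partition_states M)) * x ^ M = (\<Sum>\<eta>\<in>partition_states M. x ^ (\<Sum>i=1..M. i * \<eta> i))"
  proof -
    have "x ^ (\<Sum>i=1..M. i * \<eta> i) = x ^ M" if "\<eta> \<in> partition_states M" for \<eta>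
      by (rule arg_cong[where f = "\<lambda>k. x ^ k"]) (use that in \<open>auto simp: partition_states_def\<close>)
    then show ?thesis by simp
  qed
  also have "\<dots> = (\<Sum>\<eta>\<in>partition_states M. \<Prod>i=1..M. (x ^ i) ^ \<eta> i)"
    by (simp add: power_sum power_mult)
  \<comment> \<open>Replacing the mass constraint by the bound \<open>M\<close> on each multiplicity
    makes the sum factorise into one geometric sum per size.\<close>
  also have "\<dots> \<le> (\<Sum>\<eta>\<in>PiE {1..M} (\<lambda>_. {..M}). \<Prod>i=1..M. (x ^ i) ^ \<eta> i)"
    using x by (intro sum_mono2 finite_PiE partition_states_subset prod_nonneg) auto
  also have "\<dots> = (\<Prod>i=1..M. \<Sum>n\<le>M. (x ^ i) ^ n)"
    by (rule prod_sum_PiE[symmetric]) auto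
  also have "\<dots> \<le> (\<Prod>i=1..M. exp (x ^ i / (1 - x)))"
  proof (intro prod_mono conjI)
    fix i assume i: "i \<in> {1..M}"
    show "0 \<le> (\<Sum>n\<le>M. (x ^ i) ^ n)" using x by (intro sum_nonneg) auto
    have le: "x ^ i \<le> x" using i x power_decreasing[of 1 i x] by simp
    have "(\<Sum>n\<le>M. (x ^ i) ^ n) \<le> (\<Sum>n. (x ^ i) ^ n)"
      using xi[of i] i by (intro sum_le_suminf summable_geometric) auto
    also have "\<dots> = 1 / (1 - x ^ i)" using xi[of i] i by (intro suminf_geometric) auto
    \<comment> \<open>In the form \<open>1 + y\<close> the factor is bounded by
      \<open>exp y\<close>, so the product turns into the exponential of a second geometric
      sum.\<close>
    also have "\<dots> = 1 + x ^ i / (1 - x ^ i)" using xi[of i] i by (simp add: field_simps)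
    also have "\<dots> \<le> 1 + x ^ i / (1 - x)" using x le by (intro add_left_mono divide_left_mono) auto
    also have "\<dots> \<le> exp (x ^ i / (1 - x))" by (rule exp_ge_add_one_self)
    finally show "(\<Sum>n\<le>M. (x ^ i) ^ n) \<le> exp (x ^ i / (1 - x))" .
  qed
  also have "\<dots> = exp ((\<Sum>i=1..M. x ^ i) / (1 - x))"
    by (simp add: exp_sum sum_divide_distrib)
  also have "\<dots> \<le> exp (1 / (1 - x) / (1 - x))"
  proof -
    have "(\<Sum>i=1..M. x ^ i) \<le> (\<Sum>i. x ^ i)"
      using x by (intro sum_le_suminf summable_geometric) auto
    also have "\<dots> = 1 / (1 - x)" using x by (intro suminf_geometric) auto
    finally have "(\<Sum>i=1..M. x ^ i) / (1 - x) \<le> 1 / (1 - x) / (1 - x)"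
      using x by (intro divide_right_mono) auto
    then show ?thesis by simp
  qed
  finally show ?thesis by (simp add: power2_eq_square)
qed

section \<open>Stirling bounds and Poisson factors\<close>

lemma ln_fact_ge: "real n * ln (real n) - real n \<le> ln (fact n)"
proof (cases "n = 0")
  case False
  \<comment> \<open>The quotient \<open>n ^ n / fact n\<close> is a single term of the exponential
    series at \<open>n\<close>.\<close>
  have "(\<Sum>k\<in>{n}. real n ^ k /\<^sub>R fact k) \<le> (\<Sum>k. real n ^ k /\<^sub>R fact k)"
    by (rule sum_le_suminf[OF summable_exp_generic]) auto
  then have "real n ^ n / fact n \<le> exp (real n)"
    by (simp add: exp_def field_simps)
  then have "ln (real n ^ n / fact n) \<le> ln (exp (real n))"
    using False by (subst ln_le_cancel_iff) auto
  then show ?thesis using False by (simp add: ln_div ln_realpow)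
qed simp

text \<open>The induction step reduces to \<open>(n + 1) * ln (n / (n + 1)) \<le> -1\<close>, an
  instance of \<open>ln y \<le> y - 1\<close>.\<close>

lemma ln_fact_le: "1 \<le> n \<Longrightarrow> ln (fact n) \<le> real n * ln (real n) - real n + ln (real n) + 1"
proof (induction n rule: dec_induct)
  case (step n)
  have n: "real n > 0" using step by simp
  have "ln (real n / real (Suc n)) \<le> real n / real (Suc n) - 1" using n by (intro ln_le_minus_one) auto
  then have "ln (real n) - ln (real (Suc n)) \<le> real n / real (Suc n) - 1" using n by (simp add: ln_div)
  then have "(real n + 1) * (ln (real n) - ln (real (Suc n))) \<le> (real n + 1) * (real n / real (Suc n) - 1)"
    using n by (intro mult_left_mono) auto
  also have "\<dots> = - 1" using n by (simp add: field_simps)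
  finally have *: "(real n + 1) * (ln (real n) - ln (real (Suc n))) \<le> - 1" .
  have "ln (fact (Suc n)) = ln (real (Suc n)) + ln (fact n)"
    using n by (simp add: ln_mult del: of_nat_Suc)
  also have "\<dots> \<le> ln (real (Suc n)) + (real n * ln (real n) - real n + ln (real n) + 1)"
    using step by simp
  also have "\<dots> \<le> real (Suc n) * ln (real (Suc n)) - real (Suc n) + ln (real (Suc n)) + 1"
    using * by (simp add: algebra_simps)
  finally show ?case .
qed simp

text \<open>\<open>V * cell_entropy c (n / V)\<close> equals
  \<open>n * ln n - n - n * ln (V * c)\<close>, so the lower Stirling bound gives the estimate
  without any error factor.\<close>

lemma poisson_factor_le:
  assumes "0 < V" "0 < c"
  shows "(V * c) ^ n / fact n \<le> exp (- V * cell_entropy c (real n / V))"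
proof (cases "n = 0")
  case False
  have "(V * c) ^ n / fact n = exp (real n * ln (V * c) - ln (fact n))"
    using assms by (simp add: exp_diff exp_of_nat_mult)
  also have "\<dots> \<le> exp (real n * ln (V * c) - (real n * ln (real n) - real n))"
    using ln_fact_ge[of n] by simp
  also have "real n * ln (V * c) - (real n * ln (real n) - real n) = - V * cell_entropy c (real n / V)"
    using assms False by (simp add: cell_entropy_def ln_div ln_mult algebra_simps)
  finally show ?thesis .
qed simp

text \<open>The factor \<open>1 / (exp 1 * n)\<close> is the price of the extra
  \<open>ln n + 1\<close> in the upper Stirling bound.\<close>

lemma poisson_factor_ge:
  assumes "0 < V" "0 < c" "1 \<le> n"
  shows "exp (- V * cell_entropy c (real n / V)) * (1 / (exp 1 * real n)) \<le> (V * c) ^ n / fact n"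
proof -
  have "- V * cell_entropy c (real n / V) = real n * ln (V * c) - (real n * ln (real n) - real n)"
    using assms by (simp add: cell_entropy_def ln_div ln_mult algebra_simps)
  moreover have "1 / (exp 1 * real n) = exp (- 1 - ln (real n))"
    using assms by (simp add: exp_diff exp_minus field_simps)
  ultimately have "exp (- V * cell_entropy c (real n / V)) * (1 / (exp 1 * real n)) =
      exp (real n * ln (V * c) - (real n * ln (real n) - real n + ln (real n) + 1))"
    by (simp flip: exp_add)
  also have "\<dots> \<le> exp (real n * ln (V * c) - ln (fact n))"
    using ln_fact_le[OF assms(3)] by simp
  also have "\<dots> = (V * c) ^ n / fact n"
    using assms by (simp add: exp_diff exp_of_nat_mult)
  finally show ?thesis .
qed

section \<open>State weights in terms of the entropy\<close>

lemma scaled_sizes_Suc: "scaled_sizes V M \<eta> (Suc r) = (if Suc r \<le> M then real (\<eta> (Suc r)) / V else 0)"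
  by (simp add: scaled_sizes_def)

lemma scaled_sizes_in_mass_ball:
  assumes "0 < V" "\<eta> \<in> partition_states M" "real M / V \<le> m"
  shows "scaled_sizes V M \<eta> \<in> mass_ball m"
proof -
  have nn: "0 \<le> scaled_sizes V M \<eta> (Suc r)" for r using assms by (simp add: scaled_sizes_Suc)
  have "partial_mass n (scaled_sizes V M \<eta>) \<le> m" for n
  proof -
    have "partial_mass n (scaled_sizes V M \<eta>) \<le> partial_mass (max n M) (scaled_sizes V M \<eta>)"
      unfolding partial_mass_def using nn by (intro sum_mono2) auto
    also have "\<dots> = partial_mass M (scaled_sizes V M \<eta>)"
      unfolding partial_mass_def by (rule sum.mono_neutral_right) (auto simp: scaled_sizes_Suc)
    also have "\<dots> = (\<Sum>i=1..M. real (i * \<eta> i)) / V"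
      by (simp add: partial_mass_def scaled_sizes_Suc sum_divide_distrib sum.atLeast1_atMost_eq)
    also have "\<dots> = real M / V"
      using assms(2) by (simp add: partition_states_def flip: of_nat_sum of_nat_mult)
    finally show ?thesis using assms(3) by simp
  qed
  moreover have "scaled_sizes V M \<eta> \<in> nonneg_seqs"
    using assms(1) by (auto simp: nonneg_seqs_def scaled_sizes_def)
  ultimately show ?thesis by (simp add: mass_ball_def)
qed

context subexponential_weights
begin

lemma entropy_scaled_sizes:
  "entropy (scaled_sizes V M \<eta>) = (\<Sum>i=1..M. cell_entropy (q i) (real (\<eta> i) / V))"
proof -
  have "entropy (scaled_sizes V M \<eta>) = (\<Sum>r<M. cell_entropy (q (Suc r)) (scaled_sizes V M \<eta> (Suc r)))"
    unfolding entropy_def by (rule suminf_finite) (auto simp: scaled_sizes_Suc)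
  also have "\<dots> = (\<Sum>r<M. cell_entropy (q (Suc r)) (real (\<eta> (Suc r)) / V))"
    by (simp add: scaled_sizes_Suc)
  finally show ?thesis by (simp add: sum.atLeast1_atMost_eq)
qed

lemma cf_weight_le:
  assumes "0 < V"
  shows "cf_weight q V M \<eta> \<le> exp (- V * entropy (scaled_sizes V M \<eta>))"
proof -
  have "cf_weight q V M \<eta> \<le> (\<Prod>i=1..M. exp (- V * cell_entropy (q i) (real (\<eta> i) / V)))"
    unfolding cf_weight_def using assms q_pos
    by (intro prod_mono conjI poisson_factor_le) (auto intro!: divide_nonneg_nonneg simp: less_imp_le)
  then show ?thesis
    by (simp only: entropy_scaled_sizes sum_distrib_left exp_sum[OF finite_atLeastAtMost])
qed

text \<open>Absent sizes contribute the exact factor 1, and a multiplicity is at most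
  \<open>M\<close>. Hence the Stirling loss is polynomial in \<open>M\<close> when the bound
  \<open>R\<close> on the occurring sizes stays fixed.\<close>

lemma cf_weight_ge:
  assumes "0 < V" "\<eta> \<in> partition_states M" "1 \<le> M" "R \<le> M"
    and supp: "\<And>i. R < i \<Longrightarrow> i \<le> M \<Longrightarrow> \<eta> i = 0"
  shows "exp (- V * entropy (scaled_sizes V M \<eta>)) * (1 / (exp 1 * real M)) ^ R \<le> cf_weight q V M \<eta>"
proof -
  \<comment> \<open>The loss is charged to every size up to \<open>R\<close>, present or not; this
    is harmless because it is at most 1.\<close>
  let ?p = "\<lambda>i. if i \<le> R then 1 / (exp 1 * real M) else 1"
  have le1: "1 / (exp 1 * real M) \<le> 1"
    using assms(3) mult_mono[of 1 "exp (1::real)" 1 "real M"] by simp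
  have "(\<Prod>i=1..M. exp (- V * cell_entropy (q i) (real (\<eta> i) / V)) * ?p i) \<le> cf_weight q V M \<eta>"
    unfolding cf_weight_def
  proof (intro prod_mono conjI)
    fix i assume i: "i \<in> {1..M}"
    show "exp (- V * cell_entropy (q i) (real (\<eta> i) / V)) * ?p i \<le> (V * q i) ^ \<eta> i / fact (\<eta> i)"
    proof (cases "\<eta> i = 0")
      case True
      then show ?thesis using le1 by simp
    next
      case False
      then have "i \<le> R" using supp[of i] i by (meson atLeastAtMost_iff not_le)
      have "1 / (exp 1 * real M) \<le> 1 / (exp 1 * real (\<eta> i))"
        using False partition_states_le[OF assms(2) i] by (intro divide_left_mono mult_left_mono) auto
      then have "exp (- V * cell_entropy (q i) (real (\<eta> i) / V)) * ?p i \<le>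
          exp (- V * cell_entropy (q i) (real (\<eta> i) / V)) * (1 / (exp 1 * real (\<eta> i)))"
        using \<open>i \<le> R\<close> by (intro mult_left_mono) auto
      also have "\<dots> \<le> (V * q i) ^ \<eta> i / fact (\<eta> i)"
        using False i assms(1) q_pos by (intro poisson_factor_ge) auto
      finally show ?thesis .
    qed
  qed auto
  moreover have "(\<Prod>i=1..M. ?p i) = (1 / (exp 1 * real M)) ^ R"
  proof -
    have "(\<Prod>i=1..M. ?p i) = (\<Prod>i=1..R. ?p i)"
      by (rule prod.mono_neutral_right) (use assms(4) in auto)
    then show ?thesis by simp
  qed
  moreover have "(\<Prod>i=1..M. exp (- V * cell_entropy (q i) (real (\<eta> i) / V))) =
      exp (- V * entropy (scaled_sizes V M \<eta>))"
    by (simp only: entropy_scaled_sizes sum_distrib_left exp_sum[OF finite_atLeastAtMost])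
  moreover have "(\<Prod>i=1..M. exp (- V * cell_entropy (q i) (real (\<eta> i) / V)) * ?p i) =
      (\<Prod>i=1..M. exp (- V * cell_entropy (q i) (real (\<eta> i) / V))) * (\<Prod>i=1..M. ?p i)"
    by (rule prod.distrib)
  ultimately show ?thesis by (simp only:)
qed

end

section \<open>Exponential bounds for the weights\<close>

lemma tendsto_coordinatewise:
  fixes f :: "'a \<Rightarrow> nat \<Rightarrow> real"
  assumes "\<And>i. ((\<lambda>k. f k i) \<longlongrightarrow> l i) F"
  shows "(f \<longlongrightarrow> l) F"
proof -
  have "limitin (product_topology (\<lambda>_. euclidean) UNIV) f l F"
    using assms by (simp add: limitin_componentwise)
  then show ?thesis by (simp add: euclidean_product_topology)
qed

context subexponential_weights
begin

text \<open>Needed because the scaled mass \<open>M / V\<close> only converges to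
  \<open>\<rho>\<close> and may exceed it. The violating sequences of mass at most
  \<open>\<rho> + 1\<close> form a compact set outside \<open>mass_ball \<rho>\<close>, so by a
  finite subcover their masses exceed \<open>\<rho>\<close> by a uniform gap.\<close>

lemma entropy_bound_neighbourhood:
  assumes C: "closed C" and a: "\<And>l. l \<in> C \<inter> mass_ball \<rho> \<Longrightarrow> a < entropy l"
  obtains \<delta> where "0 < \<delta>" "\<And>l. l \<in> C \<inter> mass_ball (\<rho> + \<delta>) \<Longrightarrow> a < entropy l"
proof -
  define D where "D = {l \<in> mass_ball (\<rho> + 1). entropy l \<le> a} \<inter> C"
  define U where "U j = (\<Union>n. {l. \<rho> + 1 / real (Suc j) < partial_mass n l})" for j
  have "compact D"
  proof -
    have "closed {l \<in> mass_ball (\<rho> + 1). entropy l \<le> a}"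
      by (rule continuous_on_closed_Collect_le[OF continuous_on_entropy continuous_on_const closed_mass_ball])
    then have "compact (mass_ball (\<rho> + 1) \<inter> ({l \<in> mass_ball (\<rho> + 1). entropy l \<le> a} \<inter> C))"
      using C by (intro compact_Int_closed compact_mass_ball closed_Int)
    also have "mass_ball (\<rho> + 1) \<inter> ({l \<in> mass_ball (\<rho> + 1). entropy l \<le> a} \<inter> C) = D"
      by (auto simp: D_def)
    finally show ?thesis .
  qed
  moreover have "open (U j)" if "j \<in> UNIV" for j
    unfolding U_def by (intro open_UN ballI open_Collect_less continuous_on_const continuous_on_partial_mass)
  moreover have "D \<subseteq> (\<Union>j\<in>UNIV. U j)"
  proof
    fix l assume l: "l \<in> D"
    then have "l \<notin> mass_ball \<rho>" using a by (auto simp: D_def not_le[symmetric])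
    then obtain n where "\<rho> < partial_mass n l"
      using l mass_ball_subset by (auto simp: mass_ball_def D_def not_le)
    then have "0 < partial_mass n l - \<rho>" by simp
    then obtain j where "1 / real (Suc j) < partial_mass n l - \<rho>"
      using nat_approx_posE by blast
    then show "l \<in> (\<Union>j\<in>UNIV. U j)" unfolding U_def
      by (intro UN_I[of j] UN_I[of n]) auto
  qed
  ultimately obtain J where J: "finite J" "D \<subseteq> (\<Union>j\<in>J. U j)"
    by (rule compactE_image)
  \<comment> \<open>Inserting 1 keeps the minimum meaningful for empty \<open>J\<close> and keeps
    the ball inside \<open>mass_ball (\<rho> + 1)\<close>.\<close>
  define \<delta> where "\<delta> = Min (insert 1 ((\<lambda>j. 1 / real (Suc j)) ` J))"
  have "0 < \<delta>" unfolding \<delta>_def using J(1) by (subst Min_gr_iff) auto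
  have \<delta>_le: "\<delta> \<le> 1" "\<And>j. j \<in> J \<Longrightarrow> \<delta> \<le> 1 / real (Suc j)"
    unfolding \<delta>_def using J(1) by (auto intro!: Min_le)
  have "a < entropy l" if l: "l \<in> C \<inter> mass_ball (\<rho> + \<delta>)" for l
  proof (rule ccontr)
    assume "\<not> a < entropy l"
    moreover have "l \<in> mass_ball (\<rho> + 1)" using l mass_ball_mono[of "\<rho> + \<delta>" "\<rho> + 1"] \<delta>_le(1) by auto
    ultimately have "l \<in> D" using l by (simp add: D_def)
    then obtain j n where j: "j \<in> J" and n: "\<rho> + 1 / real (Suc j) < partial_mass n l"
      using J(2) unfolding U_def by blast
    from l have "partial_mass n l \<le> \<rho> + \<delta>" by (simp add: mass_ball_def)
    with \<delta>_le(2)[OF j] n show False by linarith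
  qed
  with \<open>0 < \<delta>\<close> show ?thesis by (rule that)
qed

text \<open>The unnormalised measure of a set of scaled states; dividing by the value on
  \<open>UNIV\<close> gives its probability.\<close>

definition weight_sum :: "real \<Rightarrow> nat \<Rightarrow> (nat \<Rightarrow> real) set \<Rightarrow> real" where
  "weight_sum V M A = (\<Sum>\<eta>\<in>{\<eta>\<in>partition_states M. scaled_sizes V M \<eta> \<in> A}. cf_weight q V M \<eta>)"

lemma cf_weight_pos: "0 < V \<Longrightarrow> 0 < cf_weight q V M \<eta>"
  unfolding cf_weight_def using q_pos by (intro prod_pos) auto

text \<open>Each weight is at most \<open>exp (- V * a)\<close>, by the entropy bound on a slightly
  larger ball, and the number of states is at most \<open>exp (V * \<epsilon>)\<close>
  eventually.\<close>

lemma weight_sum_upper: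
  assumes M: "((\<lambda>V. real (M V) / V) \<longlongrightarrow> \<rho>) at_top" and \<rho>: "0 < \<rho>"
    and C: "closed C" and a: "\<And>l. l \<in> C \<inter> mass_ball \<rho> \<Longrightarrow> a < entropy l"
    and \<epsilon>: "0 < \<epsilon>"
  shows "\<forall>\<^sub>F V in at_top. weight_sum V (M V) C \<le> exp (- V * (a - \<epsilon>))"
proof -
  obtain \<delta> where \<delta>: "0 < \<delta>" "\<And>l. l \<in> C \<inter> mass_ball (\<rho> + \<delta>) \<Longrightarrow> a < entropy l"
    using entropy_bound_neighbourhood[OF C a] by blast
  \<comment> \<open>Eventually \<open>M V \<le> (\<rho> + 1) * V\<close>, so the factor
    \<open>exp (s * M V)\<close> from the partition count uses only half of
    \<open>\<epsilon>\<close>.\<close>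
  define s where "s = \<epsilon> / (2 * (\<rho> + 1))"
  define x where "x = exp (- s)"
  have s: "0 < s" using \<epsilon> \<rho> by (simp add: s_def)
  then have x: "0 < x" "x < 1" by (auto simp: x_def)
  have "\<forall>\<^sub>F V in at_top. real (M V) / V < \<rho> + min \<delta> 1"
    using \<delta>(1) by (intro order_tendstoD(2)[OF M]) auto
  \<comment> \<open>Beyond this threshold the constant in the partition count fits into the other
    half of \<open>\<epsilon>\<close>.\<close>
  moreover have "\<forall>\<^sub>F V in at_top. 2 * (1 / (1 - x)\<^sup>2) / \<epsilon> \<le> (V::real)" by (rule eventually_ge_at_top)
  moreover have "\<forall>\<^sub>F V in at_top. 0 < (V::real)" by (rule eventually_gt_at_top)
  ultimately show ?thesis
  proof eventually_elim
    case (elim V)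
    let ?m = "M V"
    have "weight_sum V ?m C \<le> (\<Sum>\<eta>\<in>{\<eta>\<in>partition_states ?m. scaled_sizes V ?m \<eta> \<in> C}. exp (- V * a))"
      unfolding weight_sum_def
    proof (rule sum_mono)
      fix \<eta> assume \<eta>: "\<eta> \<in> {\<eta>\<in>partition_states ?m. scaled_sizes V ?m \<eta> \<in> C}"
      then have "scaled_sizes V ?m \<eta> \<in> mass_ball (\<rho> + \<delta>)"
        using elim by (intro scaled_sizes_in_mass_ball) auto
      with \<eta> have "a < entropy (scaled_sizes V ?m \<eta>)" by (intro \<delta>(2)) auto
      with elim have "exp (- V * entropy (scaled_sizes V ?m \<eta>)) \<le> exp (- V * a)" by simp
      with cf_weight_le[of V ?m \<eta>] elim show "cf_weight q V ?m \<eta> \<le> exp (- V * a)" by linarith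
    qed
    also have "\<dots> \<le> (\<Sum>\<eta>\<in>partition_states ?m. exp (- V * a))" by (rule sum_mono2) auto
    also have "\<dots> = real (card (partition_states ?m)) * exp (- V * a)" by simp
    also have "real (card (partition_states ?m)) \<le> exp (V * \<epsilon>)"
    proof -
      have "x ^ ?m = exp (- (s * real ?m))" by (simp add: x_def flip: exp_of_nat_mult)
      then have "real (card (partition_states ?m)) = (real (card (partition_states ?m)) * x ^ ?m) * exp (s * real ?m)"
        by (simp add: mult.assoc flip: exp_add)
      also have "\<dots> \<le> exp (1 / (1 - x)\<^sup>2) * exp (s * real ?m)"
        by (intro mult_right_mono card_partition_states_le x) auto
      also have "\<dots> = exp (1 / (1 - x)\<^sup>2 + s * real ?m)" by (simp add: exp_add)
      also have "\<dots> \<le> exp (V * \<epsilon>)"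
      proof -
        have "1 / (1 - x)\<^sup>2 \<le> V * \<epsilon> / 2"
          using elim(2)[unfolded pos_divide_le_eq[OF \<epsilon>]] by linarith
        moreover have "s * real ?m \<le> V * \<epsilon> / 2"
        proof -
          have "real ?m / V \<le> \<rho> + 1" using elim(1) by linarith
          then have "real ?m \<le> (\<rho> + 1) * V" using elim(3) by (simp add: divide_le_eq)
          then have "s * real ?m \<le> s * ((\<rho> + 1) * V)" using s by (intro mult_left_mono) auto
          also have "\<dots> = V * \<epsilon> / 2" using \<rho> by (simp add: s_def field_simps)
          finally show ?thesis .
        qed
        ultimately show ?thesis by simp
      qed
      finally show ?thesis .
    qed
    finally show ?case by (simp add: right_diff_distrib mult_right_mono flip: exp_add)
  qed
qed

text \<open>The weight of a single state suffices: multiplicities of sizes from 2 to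
  \<open>n\<close> are rounded down, and size 1 takes the remaining mass. The scaled states converge
  to \<open>l\<close>, so they enter \<open>U\<close> and their entropies converge by
  continuity.\<close>

lemma weight_sum_lower_finite:
  assumes M: "((\<lambda>V. real (M V) / V) \<longlongrightarrow> \<rho>) at_top" and \<rho>: "0 < \<rho>"
    and U: "open U" "l \<in> U" "l \<in> mass_ball \<rho>"
    and supp: "\<And>r. n \<le> r \<Longrightarrow> l (Suc r) = 0" and mass: "partial_mass n l = \<rho>" and l1: "0 < l 1"
    and \<epsilon>: "0 < \<epsilon>"
  shows "\<forall>\<^sub>F V in at_top. exp (- V * (entropy l + \<epsilon>)) \<le> weight_sum V (M V) U"
proof -
  have n: "1 \<le> n" using l1 supp[of 0] by (cases n) auto
  have l0: "0 \<le> l i" if "1 \<le> i" for i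
    using U(3) that by (cases i) (auto simp: mass_ball_def nonneg_seqsD)
  have mass': "(\<Sum>i=2..n. real i * l i) = \<rho> - l 1"
  proof -
    have "\<rho> = (\<Sum>i=1..n. real i * l i)"
      using mass by (simp add: partial_mass_def sum.atLeast1_atMost_eq)
    also have "\<dots> = l 1 + (\<Sum>i=2..n. real i * l i)"
      using n by (simp add: sum.atLeast_Suc_atMost numeral_2_eq_2)
    finally show ?thesis by simp
  qed
  define f where "f V i = nat \<lfloor>V * l i\<rfloor>" for V :: real and i
  define S where "S V = (\<Sum>i=2..n. i * f V i)" for V
  \<comment> \<open>The subtraction on \<open>nat\<close> is not truncated for large
    \<open>V\<close>, by \<open>ev_S\<close> below.\<close>
  define \<eta> where "\<eta> V = (\<lambda>i\<in>{1..M V}. if i = 1 then M V - S V else if i \<le> n then f V i else 0)" for V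
  have f_lim: "((\<lambda>V. real (f V i) / V) \<longlongrightarrow> l i) at_top" if "1 \<le> i" for i
  proof (rule tendsto_sandwich)
    have ev: "\<forall>\<^sub>F V in at_top. 0 < (V::real)" by (rule eventually_gt_at_top)
    show "\<forall>\<^sub>F V in at_top. l i - 1 / V \<le> real (f V i) / V"
      using ev
    proof eventually_elim
      case (elim V)
      have "V * l i - 1 \<le> real (f V i)" unfolding f_def by linarith
      then have "(V * l i - 1) / V \<le> real (f V i) / V" using elim by (intro divide_right_mono) auto
      with elim show ?case by (simp add: diff_divide_distrib)
    qed
    show "\<forall>\<^sub>F V in at_top. real (f V i) / V \<le> l i"
      using ev
    proof eventually_elim
      case (elim V)
      have "real (f V i) \<le> V * l i" unfolding f_def using elim l0[OF that] by (simp add: of_nat_nat)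
      with elim show ?case by (simp add: field_simps)
    qed
    show "((\<lambda>V. l i - 1 / V) \<longlongrightarrow> l i) at_top" by real_asymp
  qed simp
  have S_lim: "((\<lambda>V. (real (M V) - real (S V)) / V) \<longlongrightarrow> l 1) at_top"
  proof -
    have "((\<lambda>V. real (M V) / V - (\<Sum>i=2..n. real i * (real (f V i) / V))) \<longlongrightarrow>
        \<rho> - (\<Sum>i=2..n. real i * l i)) at_top"
      by (intro tendsto_diff M tendsto_sum tendsto_mult tendsto_const f_lim) auto
    then show ?thesis
      by (simp add: mass' S_def diff_divide_distrib sum_divide_distrib)
  qed
  have M_top: "filterlim (\<lambda>V. real (M V)) at_top at_top"
  proof -
    have "filterlim (\<lambda>V. (real (M V) / V) * V) at_top at_top"
      by (rule filterlim_tendsto_pos_mult_at_top[OF M \<rho> filterlim_ident])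
    then show ?thesis
      by (rule filterlim_mono_eventually[OF _ order_refl order_refl])
        (use eventually_gt_at_top[of 0] in eventually_elim, simp)
  qed
  have ev_M: "\<forall>\<^sub>F V in at_top. n \<le> M V"
    using M_top[unfolded filterlim_at_top, rule_format, of "real n"] by simp
  \<comment> \<open>Here \<open>0 < l 1\<close> is essential: the mass left for size 1 is
    asymptotically \<open>V * l 1\<close>, hence eventually positive.\<close>
  have ev_S: "\<forall>\<^sub>F V in at_top. S V \<le> M V"
    using order_tendstoD(1)[OF S_lim l1] eventually_gt_at_top[of 0]
    by eventually_elim (simp add: zero_less_divide_iff)
  have \<eta>_in: "\<forall>\<^sub>F V in at_top. \<eta> V \<in> partition_states (M V)"
    using ev_M ev_S
  proof eventually_elim
    case (elim V)
    have "(\<Sum>i=1..M V. i * \<eta> V i) = (\<Sum>i=1..n. i * \<eta> V i)"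
      by (rule sum.mono_neutral_right) (use elim n in \<open>auto simp: \<eta>_def\<close>)
    also have "\<dots> = \<eta> V 1 + (\<Sum>i=2..n. i * \<eta> V i)"
      using n by (simp add: sum.atLeast_Suc_atMost numeral_2_eq_2)
    also have "(\<Sum>i=2..n. i * \<eta> V i) = S V"
      unfolding S_def by (rule sum.cong) (use elim in \<open>auto simp: \<eta>_def\<close>)
    also have "\<eta> V 1 + S V = M V" using elim n by (simp add: \<eta>_def)
    finally show ?case by (simp add: partition_states_def \<eta>_def)
  qed
  define X where "X V = scaled_sizes V (M V) (\<eta> V)" for V
  have X_lim: "(X \<longlongrightarrow> l) at_top"
  proof (rule tendsto_coordinatewise)
    fix i
    consider "i = 0" | "i = 1" | "2 \<le> i" "i \<le> n" | "i > n" "2 \<le> i" by linarith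
    then show "((\<lambda>V. X V i) \<longlongrightarrow> l i) at_top"
    proof cases
      case 1
      then show ?thesis
        using U(3) by (simp add: X_def scaled_sizes_def nonneg_seqs_at_0 mass_ball_def)
    next
      case 2
      have "\<forall>\<^sub>F V in at_top. (real (M V) - real (S V)) / V = X V i"
        using ev_M ev_S
        by eventually_elim (use n 2 in \<open>simp add: X_def scaled_sizes_def \<eta>_def of_nat_diff\<close>)
      with S_lim show ?thesis unfolding 2 by (rule Lim_transform_eventually)
    next
      case 3
      have "\<forall>\<^sub>F V in at_top. real (f V i) / V = X V i"
        using ev_M by eventually_elim (use 3 in \<open>simp add: X_def scaled_sizes_def \<eta>_def\<close>)
      moreover have "((\<lambda>V. real (f V i) / V) \<longlongrightarrow> l i) at_top" using 3 by (intro f_lim) simp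
      ultimately show ?thesis by (rule Lim_transform_eventually[rotated])
    next
      case 4
      then have "l i = 0" using supp[of "i - 1"] by simp
      moreover have "X V i = 0" for V using 4 by (simp add: X_def scaled_sizes_def \<eta>_def)
      ultimately show ?thesis by simp
    qed
  qed
  \<comment> \<open>The radius is enlarged because the scaled state has mass \<open>M V / V\<close>,
    possibly above \<open>\<rho>\<close>.\<close>
  have X_in: "\<forall>\<^sub>F V in at_top. X V \<in> mass_ball (\<rho> + 1)"
  proof -
    have "\<forall>\<^sub>F V in at_top. real (M V) / V < \<rho> + 1" by (intro order_tendstoD(2)[OF M]) auto
    with \<eta>_in eventually_gt_at_top[of 0] show ?thesis
      by eventually_elim (auto simp: X_def intro: scaled_sizes_in_mass_ball)
  qed
  have "l \<in> mass_ball (\<rho> + 1)" using U(3) mass_ball_mono[of \<rho> "\<rho> + 1"] by auto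
  then have "((\<lambda>V. entropy (X V)) \<longlongrightarrow> entropy l) at_top"
    using X_in by (intro continuous_on_tendsto_compose[OF continuous_on_entropy X_lim])
  then have ev_ent: "\<forall>\<^sub>F V in at_top. entropy (X V) < entropy l + \<epsilon> / 2"
    using \<epsilon> by (intro order_tendstoD(2)) auto
  have ev_U: "\<forall>\<^sub>F V in at_top. X V \<in> U"
    using X_lim U(1,2) by (rule topological_tendstoD)
  \<comment> \<open>With \<open>n\<close> fixed, the loss from \<open>cf_weight_ge\<close> is only
    polynomial and fits into half of \<open>\<epsilon>\<close>.\<close>
  have ev_ln: "\<forall>\<^sub>F V in at_top. real n * (1 + ln (real (M V))) \<le> V * \<epsilon> / 2"
  proof -
    have "((\<lambda>V. real n * (1 + ln ((\<rho> + 1) * V)) / V) \<longlongrightarrow> 0) at_top" using \<rho> by real_asymp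
    then have "\<forall>\<^sub>F V in at_top. real n * (1 + ln ((\<rho> + 1) * V)) / V < \<epsilon> / 2"
      using \<epsilon> by (intro order_tendstoD(2)) auto
    moreover have "\<forall>\<^sub>F V in at_top. real (M V) / V < \<rho> + 1" by (intro order_tendstoD(2)[OF M]) auto
    ultimately show ?thesis using ev_M eventually_gt_at_top[of 0]
    proof eventually_elim
      case (elim V)
      have "ln (real (M V)) \<le> ln ((\<rho> + 1) * V)"
        using elim n by (intro ln_mono) (auto simp: divide_less_eq)
      then have "real n * (1 + ln (real (M V))) \<le> real n * (1 + ln ((\<rho> + 1) * V))"
        by (intro mult_left_mono) auto
      also have "\<dots> \<le> V * \<epsilon> / 2" using elim by (simp add: divide_less_eq algebra_simps)
      finally show ?case .
    qed
  qed
  show ?thesis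
    using ev_M \<eta>_in ev_ent ev_U ev_ln eventually_gt_at_top[of 0]
  proof eventually_elim
    case (elim V)
    have M1: "1 \<le> M V" using elim n by simp
    have "exp (- V * (entropy l + \<epsilon>)) \<le> exp (- V * entropy (X V) - real n * (1 + ln (real (M V))))"
    proof -
      have "V * entropy (X V) \<le> V * (entropy l + \<epsilon> / 2)"
        using elim by (intro mult_left_mono) auto
      then show ?thesis using elim(5) by (simp add: algebra_simps)
    qed
    also have "\<dots> = exp (- V * entropy (X V)) * (1 / (exp 1 * real (M V))) ^ n"
      using M1 by (simp add: exp_diff exp_of_nat_mult exp_add power_divide)
    also have "\<dots> \<le> cf_weight q V (M V) (\<eta> V)"
      unfolding X_def using elim M1 n by (intro cf_weight_ge) (auto simp: \<eta>_def)
    also have "\<dots> \<le> weight_sum V (M V) U"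
      unfolding weight_sum_def
      using elim by (intro member_le_sum) (auto simp: X_def less_imp_le[OF cf_weight_pos])
    finally show ?case .
  qed
qed

text \<open>A sequence in the mass ball is approximated by finitely supported ones of mass exactly \<open>\<rho>\<close>: the
  missing mass is carried by one far-away coordinate, at negligible entropy cost. A little mass at size
  1 absorbs the rounding errors in the lower bound.\<close>

lemma finite_approximation:
  assumes \<rho>: "0 < \<rho>" and U: "open U" "l \<in> U" and l: "l \<in> mass_ball \<rho>" and \<epsilon>: "0 < \<epsilon>"
  obtains l' n where "l' \<in> U" "l' \<in> mass_ball \<rho>" "\<And>r. n \<le> r \<Longrightarrow> l' (Suc r) = 0"
    "partial_mass n l' = \<rho>" "0 < l' 1" "entropy l' < entropy l + \<epsilon>"
proof -
  \<comment> \<open>Shrinking \<open>l\<close> by \<open>t n\<close> frees the mass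
    \<open>(1 - t n) * \<rho>\<close> for size 1; the shift by 2 keeps \<open>t n\<close> strictly
    between 0 and 1 for every \<open>n\<close>.\<close>
  define t where "t n = 1 - 1 / real (n + 2)" for n
  have t: "0 < t n" "t n < 1" for n by (auto simp: t_def)
  have t_lim: "t \<longlonglongrightarrow> 1" unfolding t_def by real_asymp
  \<comment> \<open>The mass of \<open>l\<close> missing from the first \<open>n\<close> sizes goes
    to size \<open>Suc n\<close>. Division by this size makes the coordinate tend to 0, so it is
    invisible in the pointwise limit.\<close>
  define b where "b n = t n * (\<rho> - partial_mass n l) / real (Suc n)" for n
  define X where "X n i = (if i = 0 then undefined
    else (if i \<le> n then t n * l i else 0) + (if i = 1 then (1 - t n) * \<rho> else 0) + (if i = Suc n then b n else 0))"
    for n i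
  have l0: "0 \<le> l (Suc r)" for r using l by (simp add: mass_ball_def nonneg_seqsD)
  have A: "0 \<le> partial_mass n l" "partial_mass n l \<le> \<rho>" for n
    using l l0 by (auto simp: mass_ball_def partial_mass_def intro!: sum_nonneg)
  have b: "0 \<le> b n" for n unfolding b_def using t[of n] A[of n] by simp
  have X0: "0 \<le> X n (Suc r)" for n r using t[of n] l0 b \<rho> by (simp add: X_def)
  have X_supp: "X n (Suc r) = 0" if "Suc n \<le> r" for n r using that by (simp add: X_def)
  have X_mass: "partial_mass (Suc n) (X n) = \<rho>" for n
  proof -
    have "partial_mass (Suc n) (X n) =
        (\<Sum>r<Suc n. (if r < n then t n * (real (Suc r) * l (Suc r)) else 0)
          + (if r = 0 then (1 - t n) * \<rho> else 0) + (if r = n then real (Suc n) * b n else 0))"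
      unfolding partial_mass_def by (rule sum.cong) (auto simp: X_def algebra_simps)
    also have "\<dots> = t n * partial_mass n l + (1 - t n) * \<rho> + real (Suc n) * b n"
      by (simp add: sum.distrib partial_mass_def sum_distrib_left)
    also have "real (Suc n) * b n = t n * (\<rho> - partial_mass n l)" by (simp add: b_def)
    finally show ?thesis by (simp add: algebra_simps)
  qed
  have X_in: "X n \<in> mass_ball \<rho>" for n
  proof -
    have "partial_mass k (X n) \<le> \<rho>" for k
    proof -
      have "partial_mass k (X n) \<le> partial_mass (max k (Suc n)) (X n)"
        unfolding partial_mass_def using X0 by (intro sum_mono2) auto
      also have "\<dots> = partial_mass (Suc n) (X n)"
        unfolding partial_mass_def by (rule sum.mono_neutral_right) (auto simp: X_supp)
      finally show ?thesis by (simp add: X_mass)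
    qed
    have "0 \<le> X n i" if "1 \<le> i" for i using X0[of n "i - 1"] that by simp
    moreover have "X n i = undefined" if "i \<notin> {1..}" for i using that by (simp add: X_def)
    ultimately have "X n \<in> nonneg_seqs" by (auto simp: nonneg_seqs_def PiE_iff extensional_def)
    with \<open>\<And>k. partial_mass k (X n) \<le> \<rho>\<close> show ?thesis by (simp add: mass_ball_def)
  qed
  have X_lim: "X \<longlonglongrightarrow> l"
  proof (rule tendsto_coordinatewise)
    fix i
    show "(\<lambda>n. X n i) \<longlonglongrightarrow> l i"
    proof (cases "i = 0")
      case True
      then show ?thesis using l by (simp add: X_def nonneg_seqs_at_0 mass_ball_def)
    next
      case False
      have "(\<lambda>n. t n * l i + (if i = 1 then (1 - t n) * \<rho> else 0)) \<longlonglongrightarrow> 1 * l i + (if i = 1 then (1 - 1) * \<rho> else 0)"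
        by (intro tendsto_add tendsto_mult t_lim tendsto_const) (auto intro!: tendsto_eq_intros t_lim)
      also have "1 * l i + (if i = 1 then (1 - 1) * \<rho> else 0) = l i" by simp
      finally have "(\<lambda>n. t n * l i + (if i = 1 then (1 - t n) * \<rho> else 0)) \<longlonglongrightarrow> l i" .
      moreover have "\<forall>\<^sub>F n in sequentially. t n * l i + (if i = 1 then (1 - t n) * \<rho> else 0) = X n i"
        using eventually_ge_at_top[of i] by eventually_elim (use False in \<open>simp add: X_def\<close>)
      ultimately show ?thesis by (rule Lim_transform_eventually)
    qed
  qed
  \<comment> \<open>Continuity of the entropy on the ball makes the relocated mass cost nothing in
    the limit.\<close>
  have "(\<lambda>n. entropy (X n)) \<longlonglongrightarrow> entropy l"
    using X_in by (intro continuous_on_tendsto_compose[OF continuous_on_entropy X_lim l]) auto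
  then have "\<forall>\<^sub>F n in sequentially. entropy (X n) < entropy l + \<epsilon>"
    using \<epsilon> by (intro order_tendstoD(2)) auto
  moreover have "\<forall>\<^sub>F n in sequentially. X n \<in> U"
    using X_lim U by (rule topological_tendstoD)
  ultimately obtain n where n: "entropy (X n) < entropy l + \<epsilon>" "X n \<in> U"
    using eventually_happens'[OF sequentially_bot eventually_conj] by blast
  moreover have "0 < X n 1"
  proof -
    have "0 < (1 - t n) * \<rho>" using t[of n] \<rho> by simp
    moreover have "0 \<le> t n * l 1" using t[of n] l0[of 0] by simp
    ultimately show ?thesis using b[of n] by (cases n) (auto simp: X_def)
  qed
  ultimately show ?thesis using X_in X_supp X_mass by (intro that[of "X n" "Suc n"]) auto
qed

text \<open>Half of \<open>\<epsilon>\<close> pays for the finitely supported approximation, half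
  for the bound at that sequence.\<close>

lemma weight_sum_lower:
  assumes M: "((\<lambda>V. real (M V) / V) \<longlongrightarrow> \<rho>) at_top" and \<rho>: "0 < \<rho>"
    and U: "open U" "l \<in> U" and l: "l \<in> mass_ball \<rho>" and \<epsilon>: "0 < \<epsilon>"
  shows "\<forall>\<^sub>F V in at_top. exp (- V * (entropy l + \<epsilon>)) \<le> weight_sum V (M V) U"
proof -
  obtain l' n where l': "l' \<in> U" "l' \<in> mass_ball \<rho>" "\<And>r. n \<le> r \<Longrightarrow> l' (Suc r) = 0"
    "partial_mass n l' = \<rho>" "0 < l' 1" "entropy l' < entropy l + \<epsilon> / 2"
    using finite_approximation[OF \<rho> U l, of "\<epsilon> / 2"] \<epsilon> by auto
  have "\<forall>\<^sub>F V in at_top. exp (- V * (entropy l' + \<epsilon> / 2)) \<le> weight_sum V (M V) U"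
    using \<epsilon> by (intro weight_sum_lower_finite[OF M \<rho> U(1) l'(1-5)]) auto
  with eventually_gt_at_top[of 0] show ?thesis
  proof eventually_elim
    case (elim V)
    have "V * (entropy l' + \<epsilon> / 2) \<le> V * (entropy l + \<epsilon>)"
      using l'(6) elim by (intro mult_left_mono) auto
    then have "exp (- V * (entropy l + \<epsilon>)) \<le> exp (- V * (entropy l' + \<epsilon> / 2))" by simp
    with elim show ?case by linarith
  qed
qed

end

section \<open>The fugacity and the rate function\<close>

locale coagulation_fragmentation_rates =
  fixes Q :: "nat \<Rightarrow> real" and L :: real
  assumes Q_pos: "\<And>r. r \<ge> 1 \<Longrightarrow> Q r > 0"
    and Q_lim: "(\<lambda>r. root r (Q r)) \<longlonglongrightarrow> L" and L_pos: "L > 0"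
begin

abbreviation "\<phi>c \<equiv> \<phi>_crit Q"

lemma phi_crit_eq: "\<phi>c = inverse L"
  unfolding \<phi>_crit_def using limI[OF Q_lim] by simp

lemma phi_crit_pos: "0 < \<phi>c"
  using L_pos by (simp add: phi_crit_eq)

definition q :: "nat \<Rightarrow> real" where "q r = Q r * \<phi>c ^ r"

sublocale subexponential_weights q
proof
  show "0 < q r" if "1 \<le> r" for r using Q_pos[OF that] phi_crit_pos by (simp add: q_def)
  have "(\<lambda>r. ln (root r (Q r)) + ln \<phi>c) \<longlonglongrightarrow> ln L + ln \<phi>c"
    by (intro tendsto_intros Q_lim) (use L_pos in auto)
  also have "ln L + ln \<phi>c = 0" using L_pos by (simp add: phi_crit_eq ln_inverse)
  finally show "(\<lambda>r. ln (q r) / real r) \<longlonglongrightarrow> 0"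
  proof (rule Lim_transform_eventually)
    show "\<forall>\<^sub>F r in sequentially. ln (root r (Q r)) + ln \<phi>c = ln (q r) / real r"
      using eventually_ge_at_top[of 1]
    proof eventually_elim
      case (elim r)
      then show ?case
        using Q_pos[OF elim] phi_crit_pos
        by (simp add: q_def ln_mult ln_realpow ln_root add_divide_distrib)
    qed
  qed
qed

section \<open>The generating function and its inverse\<close>

lemma F_gen_term_nonneg: "0 \<le> \<phi> \<Longrightarrow> 0 \<le> real (Suc r) * Q (Suc r) * \<phi> ^ Suc r"
  using Q_pos[of "Suc r"] by simp

lemma F_gen_mono: "0 \<le> \<phi> \<Longrightarrow> \<phi> \<le> \<phi>' \<Longrightarrow> F_gen Q \<phi> \<le> F_gen Q \<phi>'"
  unfolding F_gen_def
  using Q_pos F_gen_term_nonneg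
  by (intro suminf_le_pos) (auto intro!: mult_left_mono power_mono simp: less_imp_le simp del: power_Suc of_nat_Suc)

lemma F_gen_finite_imp_sums:
  assumes "0 \<le> \<phi>" "F_gen Q \<phi> = ereal \<rho>"
  shows "(\<lambda>r. real (Suc r) * Q (Suc r) * \<phi> ^ Suc r) sums \<rho>"
proof -
  have "summable (\<lambda>r. real (Suc r) * Q (Suc r) * \<phi> ^ Suc r)"
    using assms(2) by (intro summable_ereal F_gen_term_nonneg assms(1)) (simp add: F_gen_def)
  moreover from suminf_ereal'[OF this] assms(2)
  have "(\<Sum>r. real (Suc r) * Q (Suc r) * \<phi> ^ Suc r) = \<rho>" by (simp add: F_gen_def)
  ultimately show ?thesis by (simp add: sums_iff)
qed

lemma F_gen_strict:
  assumes "0 \<le> \<phi>" "\<phi> < \<phi>'" "F_gen Q \<phi>' = ereal \<rho>'" "F_gen Q \<phi> = ereal \<rho>"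
  shows "\<rho> < \<rho>'"
proof -
  have s: "(\<lambda>r. real (Suc r) * Q (Suc r) * \<phi>' ^ Suc r - real (Suc r) * Q (Suc r) * \<phi> ^ Suc r) sums (\<rho>' - \<rho>)"
    using assms by (intro sums_diff F_gen_finite_imp_sums) auto
  \<comment> \<open>All terms are nonnegative, and the one at index 0, which belongs to size 1, is
    strictly positive.\<close>
  have "0 < (\<Sum>r. real (Suc r) * Q (Suc r) * \<phi>' ^ Suc r - real (Suc r) * Q (Suc r) * \<phi> ^ Suc r)"
  proof (rule suminf_pos2[where i = 0])
    show "0 \<le> real (Suc r) * Q (Suc r) * \<phi>' ^ Suc r - real (Suc r) * Q (Suc r) * \<phi> ^ Suc r" for r
      using assms Q_pos[of "Suc r"] by (simp del: power_Suc of_nat_Suc add: power_mono mult_left_mono)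
  qed (use s Q_pos[of 1] assms in \<open>auto simp: sums_iff\<close>)
  with s show ?thesis by (simp add: sums_iff)
qed

text \<open>Each partial sum at \<open>\<phi>c\<close> is the left limit of partial sums bounded by
  \<open>\<rho>_crit Q\<close>, so the terms being nonnegative settles the convergent and the
  divergent case at once.\<close>

lemma F_gen_at_phi_crit: "F_gen Q \<phi>c = \<rho>_crit Q"
proof (rule antisym)
  have "(\<Sum>r<n. ereal (real (Suc r) * Q (Suc r) * \<phi>c ^ Suc r)) \<le> \<rho>_crit Q" for n
  proof -
    define p where "p \<phi> = (\<Sum>r<n. real (Suc r) * Q (Suc r) * \<phi> ^ Suc r)" for \<phi>
    have "isCont p \<phi>c" unfolding p_def by (intro continuous_intros)
    then have "(p \<longlongrightarrow> p \<phi>c) (at_left \<phi>c)"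
      by (simp add: isCont_def filterlim_at_split)
    then have "((\<lambda>\<phi>. ereal (p \<phi>)) \<longlongrightarrow> ereal (p \<phi>c)) (at_left \<phi>c)" by (rule tendsto_ereal)
    moreover have "\<forall>\<^sub>F \<phi> in at_left \<phi>c. ereal (p \<phi>) \<le> \<rho>_crit Q"
    proof -
      have "\<forall>\<^sub>F \<phi> in at_left \<phi>c. \<phi> \<in> {0<..<\<phi>c}"
        using phi_crit_pos by (rule eventually_at_leftI[rotated])
      then show ?thesis
      proof eventually_elim
        case (elim \<phi>)
        have "ereal (p \<phi>) = (\<Sum>r<n. ereal (real (Suc r) * Q (Suc r) * \<phi> ^ Suc r))"
          by (simp add: p_def)
        also have "\<dots> \<le> F_gen Q \<phi>"
          unfolding F_gen_def using elim F_gen_term_nonneg by (intro suminf_upper) auto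
        also have "\<dots> \<le> \<rho>_crit Q"
          unfolding \<rho>_crit_def using elim by (intro SUP_upper) auto
        finally show ?case .
      qed
    qed
    ultimately have "ereal (p \<phi>c) \<le> \<rho>_crit Q"
      by (rule tendsto_upperbound) simp
    then show ?thesis by (simp add: p_def)
  qed
  then show "F_gen Q \<phi>c \<le> \<rho>_crit Q"
    unfolding F_gen_def using phi_crit_pos F_gen_term_nonneg by (intro suminf_bound) auto
  show "\<rho>_crit Q \<le> F_gen Q \<phi>c"
    unfolding \<rho>_crit_def by (intro SUP_least F_gen_mono) auto
qed

text \<open>Root test: the roots tend to \<open>L * \<phi>\<close>, which is below 1.\<close>

lemma summable_F_gen:
  assumes "0 \<le> \<phi>" "\<phi> < \<phi>c"
  shows "summable (\<lambda>r. (real r * Q r) * \<phi> ^ r)"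
proof (rule root_test_convergence)
  have "(\<lambda>r. root r (real r) * root r (Q r) * \<phi>) \<longlonglongrightarrow> 1 * L * \<phi>"
    by (intro tendsto_intros LIMSEQ_root Q_lim)
  then show "(\<lambda>r. root r (norm ((real r * Q r) * \<phi> ^ r))) \<longlonglongrightarrow> 1 * L * \<phi>"
  proof (rule Lim_transform_eventually)
    show "\<forall>\<^sub>F r in sequentially. root r (real r) * root r (Q r) * \<phi> = root r (norm ((real r * Q r) * \<phi> ^ r))"
      using eventually_ge_at_top[of 1]
    proof eventually_elim
      case (elim r)
      have "norm ((real r * Q r) * \<phi> ^ r) = real r * Q r * \<phi> ^ r"
        using Q_pos[OF elim] assms by simp
      then show ?case using elim assms by (simp add: real_root_mult real_root_power_cancel)
    qed
  qed
  show "1 * L * \<phi> < 1" using assms L_pos by (simp add: phi_crit_eq field_simps)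
qed

lemma F_gen_eq_powser:
  assumes "0 \<le> \<phi>" "\<phi> < \<phi>c"
  shows "F_gen Q \<phi> = ereal (\<Sum>r. (real r * Q r) * \<phi> ^ r)"
proof -
  have "(\<lambda>r. (real r * Q r) * \<phi> ^ r) sums (\<Sum>r. (real r * Q r) * \<phi> ^ r)"
    using summable_F_gen[OF assms] by (rule summable_sums)
  then have "(\<lambda>r. (real (Suc r) * Q (Suc r)) * \<phi> ^ Suc r) sums (\<Sum>r. (real r * Q r) * \<phi> ^ r)"
    by (subst sums_Suc_iff) simp
  then show ?thesis unfolding F_gen_def by (auto simp: sums_iff suminf_ereal' simp del: of_nat_Suc power_Suc)
qed

lemma F_gen_root_exists:
  assumes "0 < \<rho>" "ereal \<rho> \<le> \<rho>_crit Q"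
  shows "\<exists>\<phi>\<in>{0..\<phi>c}. F_gen Q \<phi> = ereal \<rho>"
proof (cases "ereal \<rho> = \<rho>_crit Q")
  case True
  then show ?thesis using F_gen_at_phi_crit phi_crit_pos by (intro bexI[of _ \<phi>c]) auto
next
  case False
  with assms have "ereal \<rho> < \<rho>_crit Q" by simp
  then obtain \<phi>1 where \<phi>1: "0 \<le> \<phi>1" "\<phi>1 < \<phi>c" "ereal \<rho> < F_gen Q \<phi>1"
    unfolding \<rho>_crit_def less_SUP_iff by auto
  \<comment> \<open>A convergence point strictly beyond \<open>\<phi>1\<close> yields continuity of
    the power series on all of \<open>[0, \<phi>1]\<close>.\<close>
  define K where "K = (\<phi>1 + \<phi>c) / 2"
  have K: "\<phi>1 < K" "K < \<phi>c" using \<phi>1 by (auto simp: K_def)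
  let ?f = "\<lambda>x. \<Sum>r. (real r * Q r) * x ^ r"
  have "\<exists>x\<ge>0. x \<le> \<phi>1 \<and> ?f x = \<rho>"
  proof (rule IVT)
    show "?f 0 \<le> \<rho>" using assms(1) powser_zero[of "\<lambda>r. real r * Q r"] by simp
    show "\<rho> \<le> ?f \<phi>1" using \<phi>1 F_gen_eq_powser[of \<phi>1] by simp
    show "\<forall>x. 0 \<le> x \<and> x \<le> \<phi>1 \<longrightarrow> isCont ?f x"
      using K \<phi>1 by (intro allI impI isCont_powser[OF summable_F_gen[of K]]) auto
  qed (rule \<phi>1)
  then obtain x where x: "0 \<le> x" "x \<le> \<phi>1" "?f x = \<rho>" by blast
  then show ?thesis using \<phi>1 F_gen_eq_powser[of x] by (intro bexI[of _ x]) auto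
qed

lemma F_gen_root_unique:
  assumes "\<phi> \<in> {0..\<phi>c}" "F_gen Q \<phi> = ereal \<rho>" "\<phi>' \<in> {0..\<phi>c}" "F_gen Q \<phi>' = ereal \<rho>"
  shows "\<phi> = \<phi>'"
  using F_gen_strict[of \<phi> \<phi>' \<rho> \<rho>] F_gen_strict[of \<phi>' \<phi> \<rho> \<rho>] assms by force

text \<open>The final alternative covers both regimes: either \<open>c_seq\<close> has mass exactly
  \<open>\<rho>\<close>, or the logarithm in the rate function is \<open>ln 1 = 0\<close>.\<close>

lemma fugacity_cases:
  assumes "0 < \<rho>"
  shows "0 < fugacity Q \<rho>" "fugacity Q \<rho> \<le> \<phi>c" "F_gen Q (fugacity Q \<rho>) \<le> ereal \<rho>"
    and "F_gen Q (fugacity Q \<rho>) = ereal \<rho> \<or> fugacity Q \<rho> = \<phi>c"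
proof -
  have "0 < fugacity Q \<rho> \<and> fugacity Q \<rho> \<le> \<phi>c \<and> F_gen Q (fugacity Q \<rho>) \<le> ereal \<rho> \<and>
    (F_gen Q (fugacity Q \<rho>) = ereal \<rho> \<or> fugacity Q \<rho> = \<phi>c)"
  proof (cases "ereal \<rho> \<le> \<rho>_crit Q")
    case True
    then have "\<exists>!\<phi>. \<phi> \<in> {0..\<phi>c} \<and> F_gen Q \<phi> = ereal \<rho>"
      using F_gen_root_exists[OF assms True] F_gen_root_unique by blast
    from theI'[OF this] have *: "fugacity Q \<rho> \<in> {0..\<phi>c} \<and> F_gen Q (fugacity Q \<rho>) = ereal \<rho>"
      using True by (simp add: fugacity_def)
    moreover have "F_gen Q 0 = 0" by (simp add: F_gen_def zero_ereal_def[symmetric])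
    with * assms have "fugacity Q \<rho> \<noteq> 0" by (auto simp: zero_ereal_def)
    ultimately show ?thesis by auto
  next
    case False
    then show ?thesis using F_gen_at_phi_crit phi_crit_pos by (auto simp: fugacity_def)
  qed
  then show "0 < fugacity Q \<rho>" "fugacity Q \<rho> \<le> \<phi>c" "F_gen Q (fugacity Q \<rho>) \<le> ereal \<rho>"
    "F_gen Q (fugacity Q \<rho>) = ereal \<rho> \<or> fugacity Q \<rho> = \<phi>c" by auto
qed

text \<open>The constant by which \<open>J_rate\<close> exceeds the entropy on
  \<open>mass_ball \<rho>\<close>; it turns out to be minus the minimum of the entropy
  there.\<close>

definition entropy_shift :: "real \<Rightarrow> real" where
  "entropy_shift \<rho> = (\<Sum>r. c_seq Q \<rho> (Suc r)) - \<rho> * ln (fugacity Q \<rho> / \<phi>c)"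

lemma c_seq_Suc: "c_seq Q \<rho> (Suc r) = Q (Suc r) * fugacity Q \<rho> ^ Suc r"
  by (simp add: c_seq_def)

lemma c_seq_pos: "0 < \<rho> \<Longrightarrow> 0 < c_seq Q \<rho> (Suc r)"
  using Q_pos[of "Suc r"] fugacity_cases(1)[of \<rho>] by (simp add: c_seq_Suc)

lemma c_seq_in_mass_ball:
  assumes "0 < \<rho>"
  shows "c_seq Q \<rho> \<in> mass_ball \<rho>" "total_mass (c_seq Q \<rho>) = F_gen Q (fugacity Q \<rho>)"
proof -
  show *: "total_mass (c_seq Q \<rho>) = F_gen Q (fugacity Q \<rho>)"
    by (simp add: total_mass_def F_gen_def c_seq_Suc mult.assoc)
  have "0 \<le> c_seq Q \<rho> i" if "i \<ge> 1" for i
    using c_seq_pos[OF assms, of "i - 1"] that by simp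
  then have "c_seq Q \<rho> \<in> nonneg_seqs" by (auto simp: nonneg_seqs_def PiE_iff c_seq_def extensional_def)
  then show "c_seq Q \<rho> \<in> mass_ball \<rho>"
    using * fugacity_cases(3)[OF assms] by (simp flip: total_mass_le_iff)
qed

lemma relative_entropy_term_nonneg:
  fixes x c :: real
  assumes "0 \<le> x" "0 < c"
  shows "0 \<le> x * ln (x / c) - x + c"
proof (cases "x = 0")
  case False
  with assms have "ln (c / x) \<le> c / x - 1" by (intro ln_le_minus_one) auto
  then have "x * ln (c / x) \<le> x * (c / x - 1)" using assms by (intro mult_left_mono) auto
  then show ?thesis using assms False by (simp add: ln_div algebra_simps)
qed (use assms in simp)

text \<open>Since \<open>ln (c r) = ln (q r) + r * ln (\<phi> / \<phi>c)\<close>, the relative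
  entropy is the entropy minus \<open>ln (\<phi> / \<phi>c)\<close> times the mass, plus the sum of
  \<open>c\<close>. The correction term in \<open>J_rate\<close> replaces the mass of
  \<open>l\<close> by \<open>\<rho>\<close>, leaving a constant. Both the relative entropy and the
  correction are nonnegative, as \<open>\<phi> \<le> \<phi>c\<close>.\<close>

lemma J_rate_eq:
  assumes \<rho>: "0 < \<rho>" and l: "l \<in> mass_ball \<rho>"
  shows "J_rate Q \<rho> l = ereal (entropy l + entropy_shift \<rho>)" "0 \<le> entropy l + entropy_shift \<rho>"
proof -
  let ?\<phi> = "fugacity Q \<rho>" and ?c = "c_seq Q \<rho>"
  define m where "m = (\<Sum>r. real (Suc r) * l (Suc r))"
  note \<phi> = fugacity_cases[OF \<rho>]
  have l0: "0 \<le> l (Suc r)" for r using l by (simp add: mass_ball_def nonneg_seqsD)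
  have m: "m \<le> \<rho>" "total_mass l = ereal m" using mass_ball_sums[OF l] by (auto simp: m_def)
  have "summable (\<lambda>r. ?c (Suc r))"
  proof (rule summable_comparison_test'[OF mass_ball_sums(1)[OF c_seq_in_mass_ball(1)[OF \<rho>]]])
    show "norm (?c (Suc r)) \<le> real (Suc r) * ?c (Suc r)" for r
      using c_seq_pos[OF \<rho>, of r] mult_right_mono[of 1 "real (Suc r)" "?c (Suc r)"] by simp
  qed
  then have "(\<lambda>r. cell_entropy (q (Suc r)) (l (Suc r)) - ln (?\<phi> / \<phi>c) * (real (Suc r) * l (Suc r)) + ?c (Suc r))
      sums (entropy l - ln (?\<phi> / \<phi>c) * m + (\<Sum>r. ?c (Suc r)))"
    unfolding m_def
    by (intro sums_add sums_diff sums_mult entropy_sums[OF l] summable_sums mass_ball_sums(1)[OF l])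
  also have "(\<lambda>r. cell_entropy (q (Suc r)) (l (Suc r)) - ln (?\<phi> / \<phi>c) * (real (Suc r) * l (Suc r)) + ?c (Suc r))
    = (\<lambda>r. l (Suc r) * ln (l (Suc r) / ?c (Suc r)) - l (Suc r) + ?c (Suc r))"
  proof
    fix r
    show "cell_entropy (q (Suc r)) (l (Suc r)) - ln (?\<phi> / \<phi>c) * (real (Suc r) * l (Suc r)) + ?c (Suc r)
      = l (Suc r) * ln (l (Suc r) / ?c (Suc r)) - l (Suc r) + ?c (Suc r)"
    proof (cases "l (Suc r) = 0")
      case False
      then have x: "0 < l (Suc r)" using l0[of r] by simp
      have Qr: "0 < Q (Suc r)" by (rule Q_pos) simp
      have "ln (?c (Suc r)) = ln (q (Suc r)) + real (Suc r) * ln (?\<phi> / \<phi>c)"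
        using Qr \<phi>(1) phi_crit_pos
        by (simp only: c_seq_Suc q_def ln_mult_pos ln_realpow ln_divide_pos zero_less_power) (simp only: right_diff_distrib)
      moreover have "ln (l (Suc r) / ?c (Suc r)) = ln (l (Suc r)) - ln (?c (Suc r))"
        using x c_seq_pos[OF \<rho>] by (intro ln_divide_pos)
      moreover have "ln (l (Suc r) / q (Suc r)) = ln (l (Suc r)) - ln (q (Suc r))"
        using x q_pos by (intro ln_divide_pos) auto
      ultimately show ?thesis by (simp only: cell_entropy_def) (simp only: algebra_simps)
    qed simp
  qed
  finally have H: "(\<lambda>r. l (Suc r) * ln (l (Suc r) / ?c (Suc r)) - l (Suc r) + ?c (Suc r)) sums
    (entropy l - ln (?\<phi> / \<phi>c) * m + (\<Sum>r. ?c (Suc r)))" .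
  have "relative_entropy_seq l ?c = ereal (entropy l - ln (?\<phi> / \<phi>c) * m + (\<Sum>r. ?c (Suc r)))"
    unfolding relative_entropy_seq_def by (simp only: suminf_ereal'[OF sums_summable[OF H]] sums_unique[OF H])
  then show "J_rate Q \<rho> l = ereal (entropy l + entropy_shift \<rho>)"
    using m by (simp add: J_rate_def entropy_shift_def algebra_simps)
  have "0 \<le> entropy l - ln (?\<phi> / \<phi>c) * m + (\<Sum>r. ?c (Suc r))"
    by (rule sums_le[OF _ sums_zero H])
      (use relative_entropy_term_nonneg[OF l0 c_seq_pos[OF \<rho>]] in auto)
  moreover have "(\<rho> - m) * ln (?\<phi> / \<phi>c) \<le> 0"
    using m \<phi> phi_crit_pos by (intro mult_nonneg_nonpos) auto
  ultimately show "0 \<le> entropy l + entropy_shift \<rho>"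
    by (simp add: entropy_shift_def algebra_simps)
qed

text \<open>The relative entropy of \<open>c_seq\<close> to itself is 0, and the correction term
  vanishes by the alternative in \<open>fugacity_cases\<close>. Together with the nonnegativity in
  \<open>J_rate_eq\<close>, this makes \<open>c_seq\<close> a minimiser of the entropy.\<close>

lemma entropy_c_seq:
  assumes \<rho>: "0 < \<rho>"
  shows "entropy (c_seq Q \<rho>) = - entropy_shift \<rho>"
proof -
  let ?\<phi> = "fugacity Q \<rho>" and ?c = "c_seq Q \<rho>"
  have 0: "?c (Suc r) * ln (?c (Suc r) / ?c (Suc r)) - ?c (Suc r) + ?c (Suc r) = 0" for r by simp
  have "relative_entropy_seq ?c ?c = 0"
    unfolding relative_entropy_seq_def 0 by (simp add: zero_ereal_def[symmetric])
  moreover have "(ereal \<rho> - total_mass ?c) * ereal (ln (?\<phi> / \<phi>c)) = 0"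
    using fugacity_cases(4)[OF \<rho>] phi_crit_pos by (auto simp: c_seq_in_mass_ball(2)[OF \<rho>])
  moreover have "total_mass ?c \<le> ereal \<rho>"
    using c_seq_in_mass_ball(2)[OF \<rho>] fugacity_cases(3)[OF \<rho>] by simp
  ultimately have "J_rate Q \<rho> ?c = 0" by (simp add: J_rate_def)
  with J_rate_eq(1)[OF \<rho> c_seq_in_mass_ball(1)[OF \<rho>]] show ?thesis by simp
qed

end

section \<open>The large deviation principle\<close>

lemma space_borel_measure_of [simp]: "space (borel_measure_of X) = topspace X"
  by (simp add: borel_measure_of_def space_measure_of_conv)

lemma openin_sets_borel_measure_of: "openin X U \<Longrightarrow> U \<in> sets (borel_measure_of X)"
  unfolding borel_measure_of_def
  by (subst sets_measure_of) (auto dest: openin_subset)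

lemma closedin_sets_borel_measure_of:
  assumes "closedin X C" shows "C \<in> sets (borel_measure_of X)"
proof -
  have "space (borel_measure_of X) - (topspace X - C) \<in> sets (borel_measure_of X)"
    using assms by (intro sets.compl_sets openin_sets_borel_measure_of) (simp add: closedin_def)
  moreover have "space (borel_measure_of X) - (topspace X - C) = C"
    using closedin_subset[OF assms] by auto
  ultimately show ?thesis by simp
qed

lemma partition_states_nonempty: "1 \<le> M \<Longrightarrow> (\<lambda>i\<in>{1..M}. if i = 1 then M else 0) \<in> partition_states M"
  by (simp add: partition_states_def if_distrib[of "\<lambda>x. _ * x"] cong: if_cong)

section \<open>From exponential bounds to logarithmic asymptotics\<close>

lemma ereal_log_divide_le:
  assumes "0 \<le> x" "x \<le> exp (V * b)" "0 < V"
  shows "ereal_log x / ereal V \<le> ereal b"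
proof (cases "x = 0")
  case False
  with assms have "ln x \<le> ln (exp (V * b))" by (subst ln_le_cancel_iff) auto
  with False assms show ?thesis by (simp add: ereal_log_def divide_le_eq mult.commute)
qed (use assms in \<open>simp add: ereal_log_def\<close>)

lemma le_ereal_log_divide:
  assumes "exp (V * b) \<le> x" "0 < V"
  shows "ereal b \<le> ereal_log x / ereal V"
proof -
  have x: "0 < x" using assms(1) exp_gt_zero by (rule less_le_trans[rotated])
  with assms have "ln (exp (V * b)) \<le> ln x" by (subst ln_le_cancel_iff) auto
  with x assms show ?thesis by (simp add: ereal_log_def le_divide_eq mult.commute)
qed

text \<open>Testing only with real \<open>a\<close> below \<open>I\<close> handles an infinite
  \<open>I\<close> as well, by density of the reals.\<close>

lemma Limsup_ereal_log_le:
  fixes p :: "real \<Rightarrow> real"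
  assumes "\<And>V. 0 \<le> p V" and "\<And>a. ereal a < I \<Longrightarrow> \<forall>\<^sub>F V in at_top. p V \<le> exp (- V * a)"
  shows "Limsup at_top (\<lambda>V. ereal_log (p V) / ereal V) \<le> - I"
proof (rule ccontr)
  assume "\<not> ?thesis"
  then obtain b where b: "- I < ereal b" "ereal b < Limsup at_top (\<lambda>V. ereal_log (p V) / ereal V)"
    using ereal_dense2[of "- I"] by (auto simp: not_le)
  then have "ereal (- b) < I" by (metis ereal_uminus_less_reorder uminus_ereal.simps(1))
  then have "\<forall>\<^sub>F V in at_top. p V \<le> exp (- V * - b)" by (rule assms(2))
  with eventually_gt_at_top[of 0] have "\<forall>\<^sub>F V in at_top. ereal_log (p V) / ereal V \<le> ereal b"
    by eventually_elim (auto intro: ereal_log_divide_le assms(1))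
  then have "Limsup at_top (\<lambda>V. ereal_log (p V) / ereal V) \<le> ereal b" by (rule Limsup_bounded)
  with b(2) show False by simp
qed

lemma le_Liminf_ereal_log:
  fixes p :: "real \<Rightarrow> real"
  assumes "\<And>\<epsilon>. 0 < \<epsilon> \<Longrightarrow> \<forall>\<^sub>F V in at_top. exp (- V * (j + \<epsilon>)) \<le> p V"
  shows "- ereal j \<le> Liminf at_top (\<lambda>V. ereal_log (p V) / ereal V)"
proof (rule ccontr)
  assume "\<not> ?thesis"
  then obtain b where b: "ereal b < - ereal j" "Liminf at_top (\<lambda>V. ereal_log (p V) / ereal V) < ereal b"
    using ereal_dense2[of _ "- ereal j"] by (auto simp: not_le)
  \<comment> \<open>The assumption is used with \<open>\<epsilon> = - b - j\<close>, positive by the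
    choice of \<open>b\<close>; the exponent is then \<open>V * b\<close>.\<close>
  then have "\<forall>\<^sub>F V in at_top. exp (- V * (j + (- b - j))) \<le> p V" by (intro assms) simp
  with eventually_gt_at_top[of 0] have "\<forall>\<^sub>F V in at_top. ereal b \<le> ereal_log (p V) / ereal V"
    by eventually_elim (auto intro: le_ereal_log_divide)
  then have "ereal b \<le> Liminf at_top (\<lambda>V. ereal_log (p V) / ereal V)" by (rule Liminf_bounded)
  with b(2) show False by simp
qed

context coagulation_fragmentation_rates
begin

lemma cf_weight_q:
  assumes "\<eta> \<in> partition_states M"
  shows "cf_weight q V M \<eta> = \<phi>c ^ M * cf_weight Q V M \<eta>"
proof -
  have "cf_weight q V M \<eta> = (\<Prod>i=1..M. \<phi>c ^ (i * \<eta> i) * ((V * Q i) ^ \<eta> i / fact (\<eta> i)))"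
    unfolding cf_weight_def
    by (rule prod.cong) (simp_all add: q_def power_mult_distrib power_mult)
  also have "\<dots> = \<phi>c ^ (\<Sum>i=1..M. i * \<eta> i) * cf_weight Q V M \<eta>"
    by (simp only: prod.distrib power_sum cf_weight_def)
  finally show ?thesis using assms by (simp add: partition_states_def)
qed

section \<open>The scaled law as a quotient of weight sums\<close>

context
  fixes V :: real and M :: nat
  assumes V: "0 < V" and M: "1 \<le> M"
begin

lemma cf_normalisation_pos: "0 < cf_normalisation Q V M"
proof -
  have "0 < cf_weight Q V M \<eta>" for \<eta>
    unfolding cf_weight_def using Q_pos V by (intro prod_pos) auto
  then show ?thesis
    unfolding cf_normalisation_def using partition_states_nonempty[OF M] by (intro sum_pos) auto
qed

lemma emeasure_cf_measure:
  assumes "X \<subseteq> partition_states M"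
  shows "emeasure (cf_measure Q V M) X = ennreal ((\<Sum>\<eta>\<in>X. cf_weight Q V M \<eta>) / cf_normalisation Q V M)"
proof -
  have "0 \<le> cf_weight Q V M \<eta> / cf_normalisation Q V M" for \<eta>
    unfolding cf_weight_def using Q_pos V cf_normalisation_pos
    by (intro divide_nonneg_nonneg prod_nonneg) (auto simp: less_imp_le)
  then show ?thesis
    unfolding cf_measure_def using assms
    by (simp add: emeasure_point_measure_finite sum_ennreal sum_divide_distrib)
qed

lemma prob_space_cf_measure: "prob_space (cf_measure Q V M)"
proof
  show "emeasure (cf_measure Q V M) (space (cf_measure Q V M)) = 1"
    using emeasure_cf_measure[OF order_refl] cf_normalisation_pos
    by (simp add: cf_measure_def space_point_measure flip: cf_normalisation_def)
qed

lemma scaled_sizes_in_nonneg_seqs: "\<eta> \<in> partition_states M \<Longrightarrow> scaled_sizes V M \<eta> \<in> nonneg_seqs"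
  using scaled_sizes_in_mass_ball[OF V _ order_refl] mass_ball_subset by blast

lemma measurable_scaled_sizes:
  "scaled_sizes V M \<in> measurable (cf_measure Q V M) (borel_measure_of nonneg_seq_topology)"
  unfolding cf_measure_def by (auto simp: scaled_sizes_in_nonneg_seqs)

lemma scaled_law_space: "prob_space (scaled_law Q V M)"
  "space (scaled_law Q V M) = topspace nonneg_seq_topology"
  "sets (scaled_law Q V M) = sets (borel_measure_of nonneg_seq_topology)"
  unfolding scaled_law_def
  using prob_space.prob_space_distr[OF prob_space_cf_measure measurable_scaled_sizes] by simp_all

text \<open>Passing from \<open>Q\<close> to \<open>q\<close> multiplies numerator and denominator
  by the same \<open>\<phi>c ^ M\<close>, which cancels.\<close>

lemma measure_scaled_law:
  assumes "A \<in> sets (borel_measure_of nonneg_seq_topology)"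
  shows "measure (scaled_law Q V M) A = weight_sum V M A / weight_sum V M UNIV"
proof -
  let ?X = "{\<eta>\<in>partition_states M. scaled_sizes V M \<eta> \<in> A}"
  have w: "weight_sum V M B = \<phi>c ^ M * (\<Sum>\<eta>\<in>{\<eta>\<in>partition_states M. scaled_sizes V M \<eta> \<in> B}. cf_weight Q V M \<eta>)" for B
    unfolding weight_sum_def sum_distrib_left by (rule sum.cong) (auto simp: cf_weight_q)
  have "scaled_sizes V M -` A \<inter> space (cf_measure Q V M) = ?X"
    by (auto simp: cf_measure_def space_point_measure)
  then have "measure (scaled_law Q V M) A = measure (cf_measure Q V M) ?X"
    unfolding scaled_law_def using measure_distr[OF measurable_scaled_sizes assms] by simp
  also have "\<dots> = (\<Sum>\<eta>\<in>?X. cf_weight Q V M \<eta>) / cf_normalisation Q V M"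
    unfolding measure_def using V Q_pos cf_normalisation_pos
    by (subst emeasure_cf_measure)
      (auto intro!: enn2real_ennreal divide_nonneg_nonneg sum_nonneg prod_nonneg simp: cf_weight_def less_imp_le)
  also have "\<dots> = weight_sum V M A / weight_sum V M UNIV"
    using phi_crit_pos by (simp add: w cf_normalisation_def)
  finally show ?thesis .
qed

lemma weight_sum_Int_nonneg_seqs: "weight_sum V M (nonneg_seqs \<inter> A) = weight_sum V M A"
  unfolding weight_sum_def using scaled_sizes_in_nonneg_seqs by (intro sum.cong) auto

end

text \<open>Sublevel sets of \<open>J_rate\<close> are sublevel sets of the entropy inside the
  compact ball, where the entropy is continuous.\<close>

lemma good_rate_function_J_rate:
  assumes \<rho>: "0 < \<rho>"
  shows "good_rate_function nonneg_seq_topology (J_rate Q \<rho>)"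
proof -
  have J: "J_rate Q \<rho> l = \<infinity>" if "l \<in> nonneg_seqs" "l \<notin> mass_ball \<rho>" for l
    using that by (simp add: J_rate_def total_mass_le_iff)
  have level: "{l \<in> nonneg_seqs. J_rate Q \<rho> l \<le> ereal a} = {l \<in> mass_ball \<rho>. entropy l \<le> a - entropy_shift \<rho>}" for a
    using J J_rate_eq(1)[OF \<rho>] mass_ball_subset by (fastforce simp: algebra_simps)
  have closed: "closed {l \<in> mass_ball \<rho>. entropy l \<le> a}" for a
    by (rule continuous_on_closed_Collect_le[OF continuous_on_entropy continuous_on_const closed_mass_ball])
  have compact: "compact {l \<in> mass_ball \<rho>. entropy l \<le> a}" for a
  proof -
    have "{l \<in> mass_ball \<rho>. entropy l \<le> a} = mass_ball \<rho> \<inter> {l \<in> mass_ball \<rho>. entropy l \<le> a}" by auto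
    then show ?thesis using compact_Int_closed[OF compact_mass_ball closed] by metis
  qed
  have subset: "{l \<in> mass_ball \<rho>. entropy l \<le> a} \<subseteq> nonneg_seqs" for a using mass_ball_subset by auto
  have "0 \<le> J_rate Q \<rho> l" if "l \<in> nonneg_seqs" for l
    using J[OF that] J_rate_eq[OF \<rho>, of l] by (cases "l \<in> mass_ball \<rho>") auto
  moreover have "closedin nonneg_seq_topology {l \<in> nonneg_seqs. J_rate Q \<rho> l \<le> ereal a}" for a
    unfolding level nonneg_seq_topology_eq by (rule closed_subset[OF subset closed])
  moreover have "compactin nonneg_seq_topology {l \<in> nonneg_seqs. J_rate Q \<rho> l \<le> ereal a}" for a
    unfolding level nonneg_seq_topology_eq using compact subset by (simp add: compactin_subtopology)
  ultimately show ?thesis by (simp add: good_rate_function_def)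
qed

text \<open>Probabilities are quotients of weight sums, and the normalisation is of exponential
  order \<open>exp (V * entropy_shift \<rho>)\<close>; this adds the shift to the entropy and
  produces \<open>J_rate\<close>.\<close>

lemma large_deviation_principle_scaled_law:
  fixes M :: "real \<Rightarrow> nat"
  assumes M_pos: "\<And>V. V > 0 \<Longrightarrow> M V \<ge> 1"
    and M_lim: "((\<lambda>V. real (M V) / V) \<longlongrightarrow> \<rho>) at_top" and \<rho>: "0 < \<rho>"
  shows "large_deviation_principle nonneg_seq_topology (\<lambda>V. scaled_law Q V (M V)) (\<lambda>V. V) at_top (J_rate Q \<rho>)"
proof -
  let ?T = nonneg_seq_topology and ?K = "entropy_shift \<rho>"
  let ?Z = "\<lambda>V. weight_sum V (M V) UNIV"
  have pos: "\<forall>\<^sub>F V in at_top. 0 < (V::real)" by (rule eventually_gt_at_top)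
  \<comment> \<open>The lower bound is applied at the minimiser \<open>c_seq\<close>, the upper
    bound below with the minimal entropy.\<close>
  have Z_lower: "\<forall>\<^sub>F V in at_top. exp (- V * (- ?K + \<epsilon>)) \<le> ?Z V" if "0 < \<epsilon>" for \<epsilon>
    using weight_sum_lower[OF M_lim \<rho> open_UNIV UNIV_I c_seq_in_mass_ball(1)[OF \<rho>] that]
    by (simp add: entropy_c_seq[OF \<rho>])
  have Z_upper: "\<forall>\<^sub>F V in at_top. ?Z V \<le> exp (- V * (- ?K - \<epsilon>))" if "0 < \<epsilon>" for \<epsilon>
  proof -
    have "- ?K - \<epsilon> / 2 < entropy l" if "l \<in> UNIV \<inter> mass_ball \<rho>" for l
      using J_rate_eq(2)[OF \<rho>, of l] that \<open>0 < \<epsilon>\<close> by auto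
    from weight_sum_upper[OF M_lim \<rho> closed_UNIV this, of "\<epsilon> / 2"] \<open>0 < \<epsilon>\<close>
    show ?thesis by (simp add: algebra_simps)
  qed
  have upper: "Limsup at_top (\<lambda>V. ereal_log (measure (scaled_law Q V (M V)) C) / ereal V) \<le> - (INF l\<in>C. J_rate Q \<rho> l)"
    if C: "closedin ?T C" for C
  proof (rule Limsup_ereal_log_le)
    fix a assume "ereal a < (INF l\<in>C. J_rate Q \<rho> l)"
    then obtain a' where a': "a < a'" "ereal a' < (INF l\<in>C. J_rate Q \<rho> l)"
      using ereal_dense2 by force
    \<comment> \<open>Numerator and denominator each lose \<open>\<epsilon>\<close>, which uses up
      exactly the gap between \<open>a'\<close> and \<open>a\<close>.\<close>
    define \<epsilon> where "\<epsilon> = (a' - a) / 2"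
    have \<epsilon>: "0 < \<epsilon>" using a' by (simp add: \<epsilon>_def)
    have "closed C" using C closedin_closed_eq[OF closed_nonneg_seqs] by (simp add: nonneg_seq_topology_eq)
    moreover have "a' - ?K < entropy l" if "l \<in> C \<inter> mass_ball \<rho>" for l
    proof -
      have "ereal a' < J_rate Q \<rho> l" using that by (intro less_le_trans[OF a'(2)] INF_lower) auto
      then show ?thesis using that J_rate_eq(1)[OF \<rho>, of l] by auto
    qed
    ultimately have "\<forall>\<^sub>F V in at_top. weight_sum V (M V) C \<le> exp (- V * (a' - ?K - \<epsilon>))"
      using \<epsilon> by (intro weight_sum_upper[OF M_lim \<rho>])
    with Z_lower[OF \<epsilon>] pos
    show "\<forall>\<^sub>F V in at_top. measure (scaled_law Q V (M V)) C \<le> exp (- V * a)"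
    proof eventually_elim
      case (elim V)
      have "measure (scaled_law Q V (M V)) C = weight_sum V (M V) C / ?Z V"
        using elim M_pos C by (intro measure_scaled_law closedin_sets_borel_measure_of) auto
      also have "\<dots> \<le> exp (- V * (a' - ?K - \<epsilon>)) / exp (- V * (- ?K + \<epsilon>))"
        using elim by (intro frac_le) auto
      also have "\<dots> = exp (- V * (a' - ?K - \<epsilon>) - - V * (- ?K + \<epsilon>))" by (rule exp_diff[symmetric])
      also have "- V * (a' - ?K - \<epsilon>) - - V * (- ?K + \<epsilon>) = - V * a"
        by (simp add: \<epsilon>_def field_simps)
      finally show ?case .
    qed
  qed simp
  have lower: "- (INF l\<in>U. J_rate Q \<rho> l) \<le> Liminf at_top (\<lambda>V. ereal_log (measure (scaled_law Q V (M V)) U) / ereal V)"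
    if U: "openin ?T U" for U
  proof -
    obtain W where W: "open W" "U = nonneg_seqs \<inter> W"
      using U by (auto simp: nonneg_seq_topology_eq openin_open)
    have "- J_rate Q \<rho> l \<le> Liminf at_top (\<lambda>V. ereal_log (measure (scaled_law Q V (M V)) U) / ereal V)"
      if l: "l \<in> U" for l
    proof (cases "l \<in> mass_ball \<rho>")
      \<comment> \<open>Outside the ball the rate is infinite and the bound is trivial.\<close>
      case False
      then have "J_rate Q \<rho> l = \<infinity>" using l W by (simp add: J_rate_def total_mass_le_iff)
      then show ?thesis by simp
    next
      case True
      show ?thesis unfolding J_rate_eq(1)[OF \<rho> True]
      proof (rule le_Liminf_ereal_log)
        fix \<epsilon> :: real assume \<epsilon>: "0 < \<epsilon>"
        have "\<forall>\<^sub>F V in at_top. exp (- V * (entropy l + \<epsilon> / 2)) \<le> weight_sum V (M V) W"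
          using \<epsilon> l W by (intro weight_sum_lower[OF M_lim \<rho> W(1) _ True]) auto
        moreover have "\<forall>\<^sub>F V in at_top. ?Z V \<le> exp (- V * (- ?K - \<epsilon> / 2))"
          using \<epsilon> by (intro Z_upper) simp
        ultimately show "\<forall>\<^sub>F V in at_top. exp (- V * (entropy l + ?K + \<epsilon>)) \<le> measure (scaled_law Q V (M V)) U"
          using Z_lower[OF \<epsilon>] pos
        proof eventually_elim
          case (elim V)
          have Z: "0 < ?Z V" using elim(3) exp_gt_zero by (rule less_le_trans[rotated])
          have "- V * (entropy l + ?K + \<epsilon>) = - V * (entropy l + \<epsilon> / 2) - - V * (- ?K - \<epsilon> / 2)"
            by (simp add: field_simps)
          then have "exp (- V * (entropy l + ?K + \<epsilon>)) = exp (- V * (entropy l + \<epsilon> / 2)) / exp (- V * (- ?K - \<epsilon> / 2))"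
            by (simp only: exp_diff)
          also have "\<dots> \<le> weight_sum V (M V) W / ?Z V"
            using elim Z by (intro frac_le) (auto intro: order_trans[OF exp_ge_zero])
          also have "\<dots> = weight_sum V (M V) U / ?Z V"
            using elim M_pos by (simp add: W(2) weight_sum_Int_nonneg_seqs)
          also have "\<dots> = measure (scaled_law Q V (M V)) U"
            using elim M_pos U by (intro measure_scaled_law[symmetric] openin_sets_borel_measure_of) auto
          finally show ?case .
        qed
      qed
    qed
    then have "- Liminf at_top (\<lambda>V. ereal_log (measure (scaled_law Q V (M V)) U) / ereal V) \<le> (INF l\<in>U. J_rate Q \<rho> l)"
      by (intro INF_greatest) (metis ereal_uminus_le_reorder)
    then show ?thesis by (metis ereal_uminus_le_reorder)
  qed
  have "\<forall>\<^sub>F V in at_top. prob_space (scaled_law Q V (M V)) \<and> space (scaled_law Q V (M V)) = topspace ?T \<and>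
      sets (scaled_law Q V (M V)) = sets (borel_measure_of ?T)"
    using pos by eventually_elim (intro conjI scaled_law_space M_pos; assumption)
  then show ?thesis
    unfolding large_deviation_principle_def using upper lower by (simp add: filterlim_ident)
qed

end

theorem theorem1:
  fixes Q :: "nat \<Rightarrow> real" and M :: "real \<Rightarrow> nat" and \<rho> L :: real
  assumes Q_pos: "\<And>r. r \<ge> 1 \<Longrightarrow> Q r > 0"
    and Q_lim: "(\<lambda>r. root r (Q r)) \<longlonglongrightarrow> L" "L > 0"
    and M_pos: "\<And>V. V > 0 \<Longrightarrow> M V \<ge> 1"
    and M_lim: "((\<lambda>V. real (M V) / V) \<longlongrightarrow> \<rho>) at_top" "\<rho> > 0"
  shows "large_deviation_principle nonneg_seq_topology (\<lambda>V. scaled_law Q V (M V)) (\<lambda>V. V) at_top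
           (J_rate Q \<rho>)
       \<and> good_rate_function nonneg_seq_topology (J_rate Q \<rho>)"
proof -
  interpret coagulation_fragmentation_rates Q L
    using Q_pos Q_lim by unfold_locales auto
  show ?thesis
    using large_deviation_principle_scaled_law[OF M_pos M_lim] good_rate_function_J_rate[OF M_lim(2)] by blast
qed

end
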